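(* An oriented geodesic congruence $\Sigma\subset\mathbb{L}(\mathbb{H}^3)$ is integrable if and only if $\Sigma$ is Lagrangian.
   Context: $\mathbb{L}(\mathbb{H}^3)$ is the space of oriented geodesics of hyperbolic 3-space $\mathbb{H}^3=\{(x^0,x^1,x^2): x^0>0\}$ with metric $\frac{(dx^0)^2+(dx^1)^2+(dx^2)^2}{(x^0)^2}$; put $z=x^1+ix^2$, $t=x^0$. It is identified with $\mathbb{P}^1\times\mathbb{P}^1-\overline{\Delta}$, $\overline{\Delta}=\{(\mu_1,\mu_2):\mu_1\bar\mu_2=-1\}$, with holomorphic coordinates $(\mu_1,\mu_2)$; the oriented geodesic with coordinates $(\mu_1,\mu_2)$ (for $\mu_2\ne0$) is parameterized by arc-length $r$ as $$z=\frac{1-\mu_1\bar\mu_2}{2\bar\mu_2}+\left(\frac{1+\mu_1\bar\mu_2}{2\bar\mu_2}\right)\tanh r,\qquad t=\frac{|1+\bar\mu_1\mu_2|}{2|\mu_2|\cosh r}.$$ The symplectic form on $\mathbb{L}(\mathbb{H}^3)$ is $$\Omega=-\left[\frac{1}{(1+\mu_1\bar\mu_2)^2}d\mu_1\wedge d\bar\mu_2+\frac{1}{(1+\bar\mu_1\mu_2)^2}d\bar\mu_1\wedge d\mu_2\right].$$ An oriented geodesic congruence is an immersed ($C^2$) surface $\Sigma\subset\mathbb{L}(\mathbb{H}^3)$, i.e. a two-parameter family of oriented geodesics. It is Lagrangian if $\Omega$ pulls back to zero on $\Sigma$. It is integrable if locally there exists an embedded surface $S$ in $\mathbb{H}^3$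 which is orthogonal to the geodesics of the congruence. *)

theory Defs
  imports "HOL-Analysis.Analysis"
begin

section \<open>Maps of class \<open>C\<^sup>2\<close> and surfaces\<close>

definition C2_on :: "'a::real_normed_vector set \<Rightarrow> ('a \<Rightarrow> 'b::real_normed_vector) \<Rightarrow> bool" where
  "C2_on U f \<longleftrightarrow> (\<exists>f' f''.
     (\<forall>x\<in>U. (f has_derivative blinfun_apply (f' x)) (at x)) \<and>
     (\<forall>x\<in>U. (f' has_derivative blinfun_apply (f'' x)) (at x)) \<and>
     continuous_on U f'')"

definition C2_immersion_on :: "'a::real_normed_vector set \<Rightarrow> ('a \<Rightarrow> 'b::real_normed_vector) \<Rightarrow> bool" where
  "C2_immersion_on U f \<longleftrightarrow>
     open U \<and> C2_on U f \<and> (\<forall>x\<in>U. inj (frechet_derivative f (at x)))"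

text \<open>An atlas is a set of pairs of a chart domain and a chart map.
  No maximality of the atlas is required.\<close>

definition C2_surface :: "'m topology \<Rightarrow> ('m set \<times> ('m \<Rightarrow> real^2)) set \<Rightarrow> bool" where
  "C2_surface M A \<longleftrightarrow>
     Hausdorff_space M \<and>
     second_countable M \<and>
     (\<Union>(U, \<phi>)\<in>A. U) = topspace M \<and>
     (\<forall>(U, \<phi>)\<in>A. openin M U \<and> open (\<phi> ` U) \<and>
        homeomorphic_map (subtopology M U) (top_of_set (\<phi> ` U)) \<phi>) \<and>
     (\<forall>(U, \<phi>)\<in>A. \<forall>(V, \<psi>)\<in>A. C2_on (\<phi> ` (U \<inter> V)) (\<psi> \<circ> inv_into U \<phi>))"


section \<open>Hyperbolic 3-space\<close>

text \<open>The point \<open>(x\<^sup>0, x\<^sup>1, x\<^sup>2)\<close> is represented by the pair \<open>(t, z)\<close> with \<open>t = x\<^sup>0\<close> and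
  \<open>z = x\<^sup>1 + \<i> x\<^sup>2\<close>.\<close>

definition H3 :: "(real \<times> complex) set" where
  "H3 = {x. fst x > 0}"

definition hyp_metric :: "real \<times> complex \<Rightarrow> real \<times> complex \<Rightarrow> real \<times> complex \<Rightarrow> real" where
  "hyp_metric x u v =
     (fst u * fst v + Re (snd u) * Re (snd v) + Im (snd u) * Im (snd v)) / (fst x)\<^sup>2"

definition embedded_surface :: "(real \<times> complex) set \<Rightarrow> bool" where
  "embedded_surface S \<longleftrightarrow> S \<subseteq> H3 \<and>
     (\<forall>x\<in>S. \<exists>V U (\<phi> :: real^2 \<Rightarrow> real \<times> complex) \<psi>.
        open V \<and> x \<in> V \<and> C2_immersion_on U \<phi> \<and> homeomorphism U (S \<inter> V) \<phi> \<psi>)"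

definition tangent_space :: "(real \<times> complex) set \<Rightarrow> real \<times> complex \<Rightarrow> (real \<times> complex) set" where
  "tangent_space S x =
     {v. \<exists>c \<epsilon>. \<epsilon> > 0 \<and> (\<forall>s::real. \<bar>s\<bar> < \<epsilon> \<longrightarrow> c s \<in> S) \<and> c 0 = x \<and>
            (c has_vector_derivative v) (at 0)}"


section \<open>The space of oriented geodesics\<close>

text \<open>The complex projective line; \<open>None\<close> is the point at infinity.\<close>

type_synonym P1 = "complex option"

definition antidiagonal :: "(P1 \<times> P1) set" where
  "antidiagonal = {(Some m1, Some m2) | m1 m2. m1 * cnj m2 = -1} \<union> {(None, Some 0), (Some 0, None)}"

definition L_H3 :: "(P1 \<times> P1) set" where
  "L_H3 = - antidiagonal"

text \<open>The geodesic with coordinates \<open>(\<mu>\<^sub>1, \<mu>\<^sub>2)\<close> runs from the boundary point \<open>-\<mu>\<^sub>1\<close> to the boundary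
  point \<open>1 / cnj \<mu>\<^sub>2\<close>. For \<open>\<mu>\<^sub>2 = \<infinity>\<close> and finite \<open>\<mu>\<^sub>1\<close>, the parametrisation is the limit of the
  generic one. If an end point is \<open>\<infinity>\<close> (that is, \<open>\<mu>\<^sub>1 = \<infinity>\<close> or \<open>\<mu>\<^sub>2 = 0\<close>) the geodesic is a vertical
  half-line, and the choice of the origin of the arc-length parameter is immaterial.
  Values off \<open>L_H3\<close> are irrelevant.\<close>

fun geodesic :: "P1 \<times> P1 \<Rightarrow> real \<Rightarrow> real \<times> complex" where
  "geodesic (Some m1, Some m2) r =
     (if m2 = 0 then (exp r, - m1)
      else (cmod (1 + cnj m1 * m2) / (2 * cmod m2 * cosh r),
            (1 - m1 * cnj m2) / (2 * cnj m2)
              + ((1 + m1 * cnj m2) / (2 * cnj m2)) * complex_of_real (tanh r)))"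
| "geodesic (Some m1, None) r =
     (cmod m1 / (2 * cosh r), - m1 / 2 + (m1 / 2) * complex_of_real (tanh r))"
| "geodesic (None, Some m2) r = (exp (- r), 1 / cnj m2)"
| "geodesic (None, None) r = (exp (- r), 0)"

text \<open>The two standard charts of the projective line: \<open>\<mu>\<close> (index \<open>False\<close>) and \<open>1 / \<mu>\<close>
  (index \<open>True\<close>).\<close>

definition P1_dom :: "bool \<Rightarrow> P1 set" where
  "P1_dom i = (if i then - {Some 0} else range Some)"

definition P1_coord :: "bool \<Rightarrow> P1 \<Rightarrow> complex" where
  "P1_coord i p = (case p of None \<Rightarrow> 0 | Some m \<Rightarrow> if i then 1 / m else m)"

definition L_dom :: "bool \<times> bool \<Rightarrow> (P1 \<times> P1) set" where
  "L_dom k = (P1_dom (fst k) \<times> P1_dom (snd k)) \<inter> L_H3"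

definition L_coord :: "bool \<times> bool \<Rightarrow> P1 \<times> P1 \<Rightarrow> complex \<times> complex" where
  "L_coord k p = (P1_coord (fst k) (fst p), P1_coord (snd k) (snd p))"

text \<open>The symplectic form at \<open>w\<close> on the tangent vectors \<open>u\<close> and \<open>v\<close>, in the coordinates
  \<open>w = (\<mu>\<^sub>1, \<mu>\<^sub>2)\<close>.\<close>

fun Omega :: "complex \<times> complex \<Rightarrow> complex \<times> complex \<Rightarrow> complex \<times> complex \<Rightarrow> complex" where
  "Omega (w1, w2) (u1, u2) (v1, v2) =
     - (1 / (1 + w1 * cnj w2)\<^sup>2 * (u1 * cnj v2 - v1 * cnj u2)
        + 1 / (1 + cnj w1 * w2)\<^sup>2 * (cnj u1 * v2 - cnj v1 * u2))"

text \<open>The same form in the coordinates \<open>(1 / \<mu>\<^sub>1, \<mu>\<^sub>2)\<close> or \<open>(\<mu>\<^sub>1, 1 / \<mu>\<^sub>2)\<close>.\<close>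

fun Omega_mixed :: "complex \<times> complex \<Rightarrow> complex \<times> complex \<Rightarrow> complex \<times> complex \<Rightarrow> complex" where
  "Omega_mixed (w1, w2) (u1, u2) (v1, v2) =
     1 / (w1 + cnj w2)\<^sup>2 * (u1 * cnj v2 - v1 * cnj u2)
     + 1 / (cnj w1 + w2)\<^sup>2 * (cnj u1 * v2 - cnj v1 * u2)"

definition L_symplectic ::
  "bool \<times> bool \<Rightarrow> complex \<times> complex \<Rightarrow> complex \<times> complex \<Rightarrow> complex \<times> complex \<Rightarrow> complex" where
  "L_symplectic k = (if fst k = snd k then Omega else Omega_mixed)"

text \<open>Under the coordinate change \<open>w \<mapsto> 1 / w\<close> in one factor, with derivative \<open>u \<mapsto> - u / w\<^sup>2\<close>, the
  expressions \<open>Omega\<close> and \<open>Omega_mixed\<close> are interchanged; so \<open>L_symplectic\<close> gives the chart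
  representatives of one 2-form, the smooth extension of \<open>Omega\<close>.\<close>

lemma Omega_mixed_eq_fst:
  assumes "w1 \<noteq> 0"
  shows "Omega_mixed (w1, w2) (u1, u2) (v1, v2) =
           Omega (1 / w1, w2) (- u1 / w1\<^sup>2, u2) (- v1 / w1\<^sup>2, v2)"
proof -
  have "1 / (1 + 1 / w1 * cnj w2)\<^sup>2 = w1\<^sup>2 / (w1 + cnj w2)\<^sup>2"
    using assms by (simp add: add_divide_eq_iff divide_add_eq_iff power_divide add.commute)
  moreover have "1 / (1 + cnj (1 / w1) * w2)\<^sup>2 = (cnj w1)\<^sup>2 / (cnj w1 + w2)\<^sup>2"
    using assms by (simp add: add_divide_eq_iff divide_add_eq_iff power_divide add.commute)
  ultimately show ?thesis
    using assms by (simp only: Omega.simps Omega_mixed.simps) (simp add: algebra_simps diff_divide_distrib)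
qed

lemma Omega_mixed_eq_snd:
  assumes "w2 \<noteq> 0"
  shows "Omega_mixed (w1, w2) (u1, u2) (v1, v2) =
           Omega (w1, 1 / w2) (u1, - u2 / w2\<^sup>2) (v1, - v2 / w2\<^sup>2)"
proof -
  have "1 / (1 + w1 * cnj (1 / w2))\<^sup>2 = (cnj w2)\<^sup>2 / (w1 + cnj w2)\<^sup>2"
    using assms by (simp add: add_divide_eq_iff divide_add_eq_iff power_divide add.commute)
  moreover have "1 / (1 + cnj w1 * (1 / w2))\<^sup>2 = w2\<^sup>2 / (cnj w1 + w2)\<^sup>2"
    using assms by (simp add: add_divide_eq_iff divide_add_eq_iff power_divide add.commute)
  ultimately show ?thesis
    using assms by (simp only: Omega.simps Omega_mixed.simps) (simp add: algebra_simps diff_divide_distrib)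
qed


section \<open>Congruences\<close>

text \<open>The congruence is the family \<open>f p\<close> of oriented geodesics indexed by the points \<open>p\<close> of the
  surface \<open>M\<close>. The openness condition, together with the \<open>C\<^sup>2\<close> condition in charts, expresses
  continuity of \<open>f\<close>.\<close>

definition local_rep ::
  "('m \<Rightarrow> P1 \<times> P1) \<Rightarrow> bool \<times> bool \<Rightarrow> 'm set \<times> ('m \<Rightarrow> real^2) \<Rightarrow> real^2 \<Rightarrow> complex \<times> complex" where
  "local_rep f k c = L_coord k \<circ> f \<circ> inv_into (fst c) (snd c)"

definition geodesic_congruence ::
  "'m topology \<Rightarrow> ('m set \<times> ('m \<Rightarrow> real^2)) set \<Rightarrow> ('m \<Rightarrow> P1 \<times> P1) \<Rightarrow> bool" where
  "geodesic_congruence M A f \<longleftrightarrow>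
     C2_surface M A \<and>
     f ` topspace M \<subseteq> L_H3 \<and>
     (\<forall>k. openin M {p \<in> topspace M. f p \<in> L_dom k}) \<and>
     (\<forall>k. \<forall>c\<in>A. C2_immersion_on (snd c ` {p \<in> fst c. f p \<in> L_dom k}) (local_rep f k c))"

definition lagrangian_congruence ::
  "'m topology \<Rightarrow> ('m set \<times> ('m \<Rightarrow> real^2)) set \<Rightarrow> ('m \<Rightarrow> P1 \<times> P1) \<Rightarrow> bool" where
  "lagrangian_congruence M A f \<longleftrightarrow>
     (\<forall>p\<in>topspace M. \<forall>c\<in>A. \<forall>k. p \<in> fst c \<and> f p \<in> L_dom k \<longrightarrow>
        (let D = frechet_derivative (local_rep f k c) (at (snd c p))
         in \<forall>u v. L_symplectic k (L_coord k (f p)) (D u) (D v) = 0))"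

text \<open>\<open>\<gamma>\<close> is required to reach \<open>S\<close>, since orthogonality at the intersection points alone would be
  vacuous for a curve missing \<open>S\<close>.\<close>

definition meets_orthogonally :: "(real \<Rightarrow> real \<times> complex) \<Rightarrow> (real \<times> complex) set \<Rightarrow> bool" where
  "meets_orthogonally \<gamma> S \<longleftrightarrow>
     range \<gamma> \<inter> S \<noteq> {} \<and>
     (\<forall>r. \<gamma> r \<in> S \<longrightarrow>
        (\<forall>v\<in>tangent_space S (\<gamma> r). hyp_metric (\<gamma> r) v (vector_derivative \<gamma> (at r)) = 0))"

definition integrable_congruence :: "'m topology \<Rightarrow> ('m \<Rightarrow> P1 \<times> P1) \<Rightarrow> bool" where
  "integrable_congruence M f \<longleftrightarrow>
     (\<forall>p\<in>topspace M. \<exists>W S. openin M W \<and> p \<in> W \<and> embedded_surface S \<and>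
        (\<forall>q\<in>W. meets_orthogonally (geodesic (f q)) S))"

end

theory Submission
  imports Defs
begin

text \<open>
  Describe an oriented geodesic by its initial end point \<open>a\<close> and by \<open>b = (e - a) / |e - a|\<^sup>2\<close>, the image
  of the final end point \<open>e\<close> under the inversion centred at \<open>a\<close>; \<open>e = \<infinity>\<close> corresponds to \<open>b = 0\<close>, so \<open>(a, b)\<close>
  are global coordinates on the geodesics with \<open>a \<noteq> \<infinity>\<close>. Parametrise each geodesic by the Busemann
  function of \<open>a\<close>, whose gradient along the geodesic is the unit velocity. If a point moves
  differentiably in space while staying on a moving geodesic, at parameter \<open>\<rho>\<close>, then the inner product of its
  displacement with the velocity of the geodesic is \<open>d\<rho> + 2 b \<bullet> da\<close> (\<open>first_variation\<close>). Hence the points at parameter \<open>\<rho>\<close>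
  move orthogonally to a family of geodesics exactly when \<open>\<rho>\<close> is a primitive of the one-form \<open>-2 b \<bullet> da\<close> on the
  parameter domain. Its exterior derivative is the pullback of \<open>-2 db \<and> da\<close>, which is the given symplectic form.
  So closedness of the one-form is the Lagrangian condition.

  From the Lagrangian condition to a surface (\<open>lagrangian_imp_orthogonal_surface\<close>), the Poincare lemma
  gives \<open>\<rho>\<close>, and the points at parameter \<open>\<rho>\<close> sweep out a surface provided that the geodesic at the base point
  is not focal there. This is arranged by the free additive constant of \<open>\<rho>\<close>: vectors of the tangent plane that are
  focal at different parameters have orthogonal \<open>da\<close>-components because the plane is isotropic, so
  at most two parameters are focal (\<open>exists_nonfocal_parameter\<close>). The required orthogonality at
  every intersection of a geodesic with the surface, and not only at the intended one, holds because
  the map from a member of the family and a parameter to the point is injective near the base point and because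
  the Busemann function keeps the parameters of all intersections close to the one at the base point.

  Conversely (\<open>orthogonal_surface_imp_lagrangian\<close>), orthogonality makes the base geodesic transversal to the
  surface, so by the inverse function theorem the neighbouring geodesics have differentiably
  varying intersection parameters. These form a primitive of the one-form, and
  the symmetry of second derivatives makes the one-form closed.

  Geodesics that start at \<open>\<infinity>\<close> end at a finite point and are treated by reversing them.
  The remaining work is to compare \<open>(a, b)\<close>, or its reversed version, with each of the
  four coordinate systems on the space of geodesics (\<open>darboux_chart_exists\<close>).
\<close>

section \<open>Calculus of maps of class C1 and C2\<close>

definition C1_on :: "'a::real_normed_vector set \<Rightarrow> ('a \<Rightarrow> 'b::real_normed_vector) \<Rightarrow> bool" where
  "C1_on U f \<longleftrightarrow> (\<exists>f'. (\<forall>x\<in>U. (f has_derivative blinfun_apply (f' x)) (at x)) \<and> continuous_on U f')"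

text \<open>Reduces the closure properties of class C2 to those of class C1 for the derivative, a map into
  a space of bounded linear functions on which composition is bilinear.\<close>

lemma C2_on_iff_C1_derivative:
  "C2_on U f \<longleftrightarrow> (\<exists>f'. (\<forall>x\<in>U. (f has_derivative blinfun_apply (f' x)) (at x)) \<and> C1_on U f')"
  unfolding C2_on_def C1_on_def by blast

lemma C1_on_imp_continuous_on: "C1_on U f \<Longrightarrow> continuous_on U f"
  unfolding C1_on_def
  by (elim exE conjE, rule has_derivative_continuous_on, rule has_derivative_at_withinI) blast

lemma C2_on_imp_C1_on: "C2_on U f \<Longrightarrow> C1_on U f"
  unfolding C2_on_iff_C1_derivative using C1_on_def C1_on_imp_continuous_on by blast

lemma C1_on_subset: "C1_on U f \<Longrightarrow> V \<subseteq> U \<Longrightarrow> C1_on V f"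
  unfolding C1_on_def by (meson continuous_on_subset subsetD)

lemma C2_on_subset: "C2_on U f \<Longrightarrow> V \<subseteq> U \<Longrightarrow> C2_on V f"
  unfolding C2_on_iff_C1_derivative by (meson C1_on_subset subsetD)

lemma C1_on_const: "C1_on U (\<lambda>x. c)"
  unfolding C1_on_def by (rule exI[of _ "\<lambda>x. 0"]) (auto simp: zero_blinfun.rep_eq)

lemma C2_on_const: "C2_on U (\<lambda>x. c)"
  unfolding C2_on_iff_C1_derivative
  by (rule exI[of _ "\<lambda>x. 0"]) (auto simp: zero_blinfun.rep_eq C1_on_const)

lemma C1_on_bounded_linear: "bounded_linear L \<Longrightarrow> C1_on U L"
  unfolding C1_on_def
  by (rule exI[of _ "\<lambda>x. Blinfun L"])
    (auto simp: bounded_linear_Blinfun_apply intro: bounded_linear_imp_has_derivative)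

lemma C2_on_bounded_linear: "bounded_linear L \<Longrightarrow> C2_on U L"
  unfolding C2_on_iff_C1_derivative
  by (rule exI[of _ "\<lambda>x. Blinfun L"])
    (auto simp: bounded_linear_Blinfun_apply C1_on_const intro: bounded_linear_imp_has_derivative)

lemma C1_on_compose:
  assumes "C1_on V g" "C1_on U f" "f ` U \<subseteq> V"
  shows "C1_on U (\<lambda>x. g (f x))"
proof -
  from assms obtain f' g' where
    f': "\<And>x. x \<in> U \<Longrightarrow> (f has_derivative blinfun_apply (f' x)) (at x)" "continuous_on U f'" and
    g': "\<And>x. x \<in> V \<Longrightarrow> (g has_derivative blinfun_apply (g' x)) (at x)" "continuous_on V g'"
    unfolding C1_on_def by metis
  have "((\<lambda>x. g (f x)) has_derivative blinfun_apply (g' (f x) o\<^sub>L f' x)) (at x)" if "x \<in> U" for x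
  proof -
    have "((\<lambda>x. g (f x)) has_derivative (\<lambda>h. g' (f x) (f' x h))) (at x)"
      using has_derivative_compose[OF f'(1)[OF that] g'(1)] that assms(3) by blast
    then show ?thesis by (simp add: blinfun_compose.rep_eq o_def)
  qed
  moreover have "continuous_on U (\<lambda>x. g' (f x) o\<^sub>L f' x)"
    by (rule bounded_bilinear.continuous_on[OF bounded_bilinear_blinfun_compose
          continuous_on_compose2[OF g'(2) C1_on_imp_continuous_on[OF assms(2)] assms(3)] f'(2)])
  ultimately show ?thesis unfolding C1_on_def by (intro exI[of _ "\<lambda>x. g' (f x) o\<^sub>L f' x"]) blast
qed

lemma C1_on_bilinear:
  assumes "bounded_bilinear B" "C1_on U f" "C1_on U g"
  shows "C1_on U (\<lambda>x. B (f x) (g x))"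
proof -
  interpret bounded_bilinear B by fact
  from assms obtain f' g' where
    f': "\<And>x. x \<in> U \<Longrightarrow> (f has_derivative blinfun_apply (f' x)) (at x)" "continuous_on U f'" and
    g': "\<And>x. x \<in> U \<Longrightarrow> (g has_derivative blinfun_apply (g' x)) (at x)" "continuous_on U g'"
    unfolding C1_on_def by metis
  have "((\<lambda>x. B (f x) (g x)) has_derivative
      blinfun_apply ((prod_right (f x) o\<^sub>L g' x) + (prod_left (g x) o\<^sub>L f' x))) (at x)" if "x \<in> U" for x
    using FDERIV[OF f'(1)[OF that] g'(1)[OF that]]
    by (simp add: plus_blinfun.rep_eq prod_right.rep_eq prod_left.rep_eq)
  moreover have "continuous_on U (\<lambda>x. (prod_right (f x) o\<^sub>L g' x) + (prod_left (g x) o\<^sub>L f' x))"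
    by (rule continuous_on_add[OF
          bounded_bilinear.continuous_on[OF bounded_bilinear_blinfun_compose
            bounded_linear.continuous_on[OF bounded_linear_prod_right C1_on_imp_continuous_on[OF assms(2)]] g'(2)]
          bounded_bilinear.continuous_on[OF bounded_bilinear_blinfun_compose
            bounded_linear.continuous_on[OF bounded_linear_prod_left C1_on_imp_continuous_on[OF assms(3)]] f'(2)]])
  ultimately show ?thesis unfolding C1_on_def by (intro exI[of _ "\<lambda>x. (prod_right (f x) o\<^sub>L g' x) + (prod_left (g x) o\<^sub>L f' x)"]) blast
qed

lemma C1_on_add:
  assumes "C1_on U f" "C1_on U g"
  shows "C1_on U (\<lambda>x. f x + g x)"
proof -
  from assms obtain f' g' where
    f': "\<And>x. x \<in> U \<Longrightarrow> (f has_derivative blinfun_apply (f' x)) (at x)" "continuous_on U f'" and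
    g': "\<And>x. x \<in> U \<Longrightarrow> (g has_derivative blinfun_apply (g' x)) (at x)" "continuous_on U g'"
    unfolding C1_on_def by metis
  then have "((\<lambda>x. f x + g x) has_derivative blinfun_apply (f' x + g' x)) (at x)" if "x \<in> U" for x
    using that by (simp add: plus_blinfun.rep_eq has_derivative_add)
  with continuous_on_add[OF f'(2) g'(2)] show ?thesis
    unfolding C1_on_def by (intro exI[of _ "\<lambda>x. f' x + g' x"]) blast
qed

lemma C1_on_linear_compose:
  "bounded_linear L \<Longrightarrow> C1_on U f \<Longrightarrow> C1_on U (\<lambda>x. L (f x))"
  using C1_on_compose[of UNIV L U f] C1_on_bounded_linear[of L UNIV] by simp

lemma C2_on_compose:
  assumes "C2_on V g" "C2_on U f" "f ` U \<subseteq> V"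
  shows "C2_on U (\<lambda>x. g (f x))"
proof -
  from assms obtain f' g' where
    f': "\<And>x. x \<in> U \<Longrightarrow> (f has_derivative blinfun_apply (f' x)) (at x)" "C1_on U f'" and
    g': "\<And>x. x \<in> V \<Longrightarrow> (g has_derivative blinfun_apply (g' x)) (at x)" "C1_on V g'"
    unfolding C2_on_iff_C1_derivative by metis
  have "((\<lambda>x. g (f x)) has_derivative blinfun_apply (g' (f x) o\<^sub>L f' x)) (at x)" if "x \<in> U" for x
  proof -
    have "((\<lambda>x. g (f x)) has_derivative (\<lambda>h. g' (f x) (f' x h))) (at x)"
      using has_derivative_compose[OF f'(1)[OF that] g'(1)] that assms(3) by blast
    then show ?thesis by (simp add: blinfun_compose.rep_eq o_def)
  qed
  moreover have "C1_on U (\<lambda>x. g' (f x) o\<^sub>L f' x)"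
    by (rule C1_on_bilinear[OF bounded_bilinear_blinfun_compose
          C1_on_compose[OF g'(2) C2_on_imp_C1_on[OF assms(2)] assms(3)] f'(2)])
  ultimately show ?thesis unfolding C2_on_iff_C1_derivative by (intro exI[of _ "\<lambda>x. g' (f x) o\<^sub>L f' x"]) blast
qed

text \<open>Covers products, inner products and scalar multiples at once.\<close>

lemma C2_on_bilinear:
  assumes "bounded_bilinear B" "C2_on U f" "C2_on U g"
  shows "C2_on U (\<lambda>x. B (f x) (g x))"
proof -
  interpret bounded_bilinear B by fact
  from assms obtain f' g' where
    f': "\<And>x. x \<in> U \<Longrightarrow> (f has_derivative blinfun_apply (f' x)) (at x)" "C1_on U f'" and
    g': "\<And>x. x \<in> U \<Longrightarrow> (g has_derivative blinfun_apply (g' x)) (at x)" "C1_on U g'"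
    unfolding C2_on_iff_C1_derivative by metis
  have "((\<lambda>x. B (f x) (g x)) has_derivative
      blinfun_apply ((prod_right (f x) o\<^sub>L g' x) + (prod_left (g x) o\<^sub>L f' x))) (at x)" if "x \<in> U" for x
    using FDERIV[OF f'(1)[OF that] g'(1)[OF that]]
    by (simp add: plus_blinfun.rep_eq prod_right.rep_eq prod_left.rep_eq)
  moreover have "C1_on U (\<lambda>x. (prod_right (f x) o\<^sub>L g' x) + (prod_left (g x) o\<^sub>L f' x))"
    by (rule C1_on_add[OF
          C1_on_bilinear[OF bounded_bilinear_blinfun_compose
            C1_on_linear_compose[OF bounded_linear_prod_right C2_on_imp_C1_on[OF assms(2)]] g'(2)]
          C1_on_bilinear[OF bounded_bilinear_blinfun_compose
            C1_on_linear_compose[OF bounded_linear_prod_left C2_on_imp_C1_on[OF assms(3)]] f'(2)]])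
  ultimately show ?thesis unfolding C2_on_iff_C1_derivative by (intro exI[of _ "\<lambda>x. (prod_right (f x) o\<^sub>L g' x) + (prod_left (g x) o\<^sub>L f' x)"]) blast
qed

lemma C2_on_linear_compose:
  "bounded_linear L \<Longrightarrow> C2_on U f \<Longrightarrow> C2_on U (\<lambda>x. L (f x))"
  using C2_on_compose[of UNIV L U f] C2_on_bounded_linear[of L UNIV] by simp

lemma C2_on_add:
  assumes "C2_on U f" "C2_on U g"
  shows "C2_on U (\<lambda>x. f x + g x)"
proof -
  from assms obtain f' g' where
    f': "\<And>x. x \<in> U \<Longrightarrow> (f has_derivative blinfun_apply (f' x)) (at x)" "C1_on U f'" and
    g': "\<And>x. x \<in> U \<Longrightarrow> (g has_derivative blinfun_apply (g' x)) (at x)" "C1_on U g'"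
    unfolding C2_on_iff_C1_derivative by metis
  then have "((\<lambda>x. f x + g x) has_derivative blinfun_apply (f' x + g' x)) (at x)" if "x \<in> U" for x
    using that by (simp add: plus_blinfun.rep_eq has_derivative_add)
  with C1_on_add[OF f'(2) g'(2)] show ?thesis
    unfolding C2_on_iff_C1_derivative by (intro exI[of _ "\<lambda>x. f' x + g' x"]) blast
qed

lemma C2_on_Pair:
  assumes "C2_on U f" "C2_on U g"
  shows "C2_on U (\<lambda>x. (f x, g x))"
proof -
  have "C2_on U (\<lambda>x. (f x, 0) + (0, g x))"
    by (intro C2_on_add C2_on_linear_compose[of "\<lambda>y. (y, 0)"] C2_on_linear_compose[of "\<lambda>y. (0, y)"]
        assms bounded_linear_Pair bounded_linear_ident bounded_linear_zero)
  then show ?thesis by simp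
qed

lemma C2_on_minus: "C2_on U f \<Longrightarrow> C2_on U (\<lambda>x. - f x)"
  by (rule C2_on_linear_compose[OF bounded_linear_minus[OF bounded_linear_ident]])

lemma C2_on_cnj: "C2_on U f \<Longrightarrow> C2_on U (\<lambda>x. cnj (f x))"
  by (rule C2_on_linear_compose[OF bounded_linear_cnj])

lemma C2_on_fst: "C2_on U f \<Longrightarrow> C2_on U (\<lambda>x. fst (f x))"
  by (rule C2_on_linear_compose[OF bounded_linear_fst])

lemma C2_on_snd: "C2_on U f \<Longrightarrow> C2_on U (\<lambda>x. snd (f x))"
  by (rule C2_on_linear_compose[OF bounded_linear_snd])

lemma C2_on_ident: "C2_on U (\<lambda>x. x)"
  by (rule C2_on_bounded_linear[OF bounded_linear_ident])

lemma C2_on_mult: "C2_on U f \<Longrightarrow> C2_on U g \<Longrightarrow> C2_on U (\<lambda>x. f x * g x :: 'b::real_normed_algebra)"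
  by (rule C2_on_bilinear[OF bounded_bilinear_mult])

lemma C2_on_has_field_derivative:
  fixes f :: "'a::real_normed_field \<Rightarrow> 'a"
  assumes "\<And>x. x \<in> U \<Longrightarrow> (f has_field_derivative f1 x) (at x)"
    and "\<And>x. x \<in> U \<Longrightarrow> (f1 has_field_derivative f2 x) (at x)"
    and "continuous_on U f2"
  shows "C2_on U f"
proof -
  have "C1_on U f1"
    unfolding C1_on_def
    by (rule exI[of _ "\<lambda>x. blinfun_mult_right (f2 x)"])
      (use assms(2,3) in \<open>auto simp: blinfun_mult_right.rep_eq has_field_derivative_def
        intro!: bounded_linear.continuous_on[OF bounded_linear_blinfun_mult_right]\<close>)
  then show ?thesis
    unfolding C2_on_iff_C1_derivative
    by (intro exI[of _ "\<lambda>x. blinfun_mult_right (f1 x)"])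
      (use assms(1) in \<open>auto simp: blinfun_mult_right.rep_eq has_field_derivative_def
        intro!: C1_on_linear_compose[OF bounded_linear_blinfun_mult_right]\<close>)
qed

lemma C2_on_inverse:
  fixes f :: "'a::real_normed_vector \<Rightarrow> 'b::real_normed_field"
  assumes "C2_on U f" "\<And>x. x \<in> U \<Longrightarrow> f x \<noteq> 0"
  shows "C2_on U (\<lambda>x. inverse (f x))"
proof -
  have "C2_on (- {0}) (inverse :: 'b \<Rightarrow> 'b)"
    by (rule C2_on_has_field_derivative[where ?f1.0 = "\<lambda>x. - (inverse x * inverse x)"
          and ?f2.0 = "\<lambda>x. 2 * (inverse x * inverse x * inverse x)"])
      (auto intro!: derivative_eq_intros continuous_intros simp: algebra_simps power2_eq_square)
  then show ?thesis by (rule C2_on_compose[OF _ assms(1)]) (use assms(2) in auto)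
qed

lemma C2_on_divide:
  fixes f :: "'a::real_normed_vector \<Rightarrow> 'b::real_normed_field"
  assumes "C2_on U f" "C2_on U g" "\<And>x. x \<in> U \<Longrightarrow> g x \<noteq> 0"
  shows "C2_on U (\<lambda>x. f x / g x)"
  using C2_on_mult[OF assms(1) C2_on_inverse[OF assms(2,3)]] by (simp add: divide_inverse)

lemma C2_on_exp:
  fixes f :: "'a::real_normed_vector \<Rightarrow> 'b::{real_normed_field,banach}"
  assumes "C2_on U f"
  shows "C2_on U (\<lambda>x. exp (f x))"
proof -
  have "C2_on UNIV (exp :: 'b \<Rightarrow> 'b)"
    by (rule C2_on_has_field_derivative[where ?f1.0 = exp and ?f2.0 = exp])
      (auto intro!: derivative_eq_intros continuous_intros)
  from C2_on_compose[OF this assms] show ?thesis by simp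
qed

lemmas C2_on_intros = C2_on_const C2_on_ident C2_on_fst C2_on_snd C2_on_Pair C2_on_add C2_on_minus
  C2_on_mult C2_on_cnj C2_on_divide C2_on_exp C2_on_inverse
  C2_on_bilinear[OF bounded_bilinear_inner] C2_on_bilinear[OF bounded_bilinear_scaleR]

section \<open>Second derivatives and closed one-forms\<close>

text \<open>The second difference of \<open>f\<close> over the parallelogram spanned by \<open>s h\<close> and \<open>s k\<close> is symmetric in
  \<open>h\<close> and \<open>k\<close>, and it is \<open>s\<^sup>2 f'' h k + o(s\<^sup>2)\<close>: the mean value theorem along \<open>k\<close> turns it into a difference of
  two values of \<open>f'\<close>, to which differentiability of \<open>f'\<close> at the corner applies.\<close>

lemma symmetric_second_derivative_real:
  fixes f :: "'a::real_normed_vector \<Rightarrow> real"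
  assumes "open U" "x0 \<in> U"
    and f': "\<And>x. x \<in> U \<Longrightarrow> (f has_derivative blinfun_apply (f' x)) (at x)"
    and f'': "(f' has_derivative f'') (at x0)"
  shows "blinfun_apply (f'' h) k = blinfun_apply (f'' k) h"
proof -
  have bl: "bounded_linear f''" using f'' by (rule has_derivative_bounded_linear)
  have main: "\<exists>d>0. \<forall>s. 0 < s \<and> s < d \<longrightarrow>
      \<bar>f (x0 + s *\<^sub>R h + s *\<^sub>R k) - f (x0 + s *\<^sub>R h) - f (x0 + s *\<^sub>R k) + f x0 - s\<^sup>2 * f'' h k\<bar> \<le> e * s\<^sup>2"
    if "e > 0" for e and h k :: 'a
  proof -
    \<comment> \<open>\<open>C\<close> absorbs the size of \<open>h\<close> and \<open>k\<close> in the two first-order errors below.\<close>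
    define C where "C = 2 * (norm h + norm k) * (norm k + 1) + 1"
    have C: "C > 0" unfolding C_def by (simp add: add_nonneg_pos)
    obtain d0 where d0: "d0 > 0" "ball x0 d0 \<subseteq> U"
      using assms(1,2) open_contains_ball by blast
    obtain d1 where d1: "d1 > 0"
      "\<And>y. norm (y - x0) < d1 \<Longrightarrow> norm (f' y - f' x0 - f'' (y - x0)) \<le> (e / C) * norm (y - x0)"
      using f'' \<open>e > 0\<close> C unfolding has_derivative_at_alt by (metis divide_pos_pos)
    define d where "d = min d0 d1 / (norm h + norm k + 1)"
    have nn: "norm h + norm k + 1 > 0" by (simp add: add_nonneg_pos)
    have "d > 0" unfolding d_def using d0 d1 nn by simp
    have "\<bar>f (x0 + s *\<^sub>R h + s *\<^sub>R k) - f (x0 + s *\<^sub>R h) - f (x0 + s *\<^sub>R k) + f x0 - s\<^sup>2 * f'' h k\<bar> \<le> e * s\<^sup>2"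
      if s: "0 < s" "s < d" for s
    proof -
      have near: "norm (a *\<^sub>R h + b *\<^sub>R k) \<le> s * (norm h + norm k)"
          "norm (a *\<^sub>R h + b *\<^sub>R k) < min d0 d1"
        if "0 \<le> a" "a \<le> s" "0 \<le> b" "b \<le> s" for a b
      proof -
        have "norm (a *\<^sub>R h + b *\<^sub>R k) \<le> a * norm h + b * norm k"
          using norm_triangle_ineq[of "a *\<^sub>R h" "b *\<^sub>R k"] that by simp
        also have "\<dots> \<le> s * norm h + s * norm k"
          using that by (intro add_mono mult_right_mono) auto
        finally show 1: "norm (a *\<^sub>R h + b *\<^sub>R k) \<le> s * (norm h + norm k)" by (simp add: algebra_simps)
        have "s * (norm h + norm k) < s * (norm h + norm k + 1)" using s by simp
        also have "\<dots> \<le> d * (norm h + norm k + 1)" using s nn by (intro mult_right_mono) auto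
        also have "\<dots> = min d0 d1" unfolding d_def using nn by simp
        finally show "norm (a *\<^sub>R h + b *\<^sub>R k) < min d0 d1" using 1 by linarith
      qed
      \<comment> \<open>The second difference is \<open>\<phi> s - \<phi> 0\<close>.\<close>
      define \<phi> where "\<phi> \<tau> = f (x0 + s *\<^sub>R h + \<tau> *\<^sub>R k) - f (x0 + 0 *\<^sub>R h + \<tau> *\<^sub>R k)" for \<tau>
      have inU: "x0 + a *\<^sub>R h + b *\<^sub>R k \<in> U" if "0 \<le> a" "a \<le> s" "0 \<le> b" "b \<le> s" for a b
        using near(2)[OF that] d0(2) by (auto simp: dist_norm subset_iff norm_minus_commute add.assoc)
      have der: "((\<lambda>\<tau>. f (x0 + a *\<^sub>R h + \<tau> *\<^sub>R k)) has_derivative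
            (\<lambda>y. y * f' (x0 + a *\<^sub>R h + \<tau> *\<^sub>R k) k)) (at \<tau>)"
        if "0 \<le> a" "a \<le> s" "0 \<le> \<tau>" "\<tau> \<le> s" for a \<tau>
      proof -
        have "((\<lambda>\<tau>. f (x0 + a *\<^sub>R h + \<tau> *\<^sub>R k)) has_derivative
            (\<lambda>y. f' (x0 + a *\<^sub>R h + \<tau> *\<^sub>R k) (y *\<^sub>R k))) (at \<tau>)"
          by (rule has_derivative_compose[where f = "\<lambda>\<tau>. x0 + a *\<^sub>R h + \<tau> *\<^sub>R k" and g = f,
                OF _ f'[OF inU[OF that]]]) (auto intro!: derivative_eq_intros)
        then show ?thesis by (simp add: blinfun.scaleR_right)
      qed
      have "\<exists>\<tau>\<in>{0<..<s}. \<phi> s - \<phi> 0 = (\<lambda>y. y * f' (x0 + s *\<^sub>R h + \<tau> *\<^sub>R k) k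
            - y * f' (x0 + 0 *\<^sub>R h + \<tau> *\<^sub>R k) k) (s - 0)"
        unfolding \<phi>_def using s
        by (intro mvt_simple has_derivative_diff has_derivative_at_withinI[OF der]) auto
      then obtain \<tau> where \<tau>: "0 < \<tau>" "\<tau> < s"
        and eq: "\<phi> s - \<phi> 0 = s * (f' (x0 + s *\<^sub>R h + \<tau> *\<^sub>R k) k - f' (x0 + 0 *\<^sub>R h + \<tau> *\<^sub>R k) k)"
        by (auto simp: algebra_simps)
      define y1 where "y1 = x0 + s *\<^sub>R h + \<tau> *\<^sub>R k"
      define y0 where "y0 = x0 + 0 *\<^sub>R h + \<tau> *\<^sub>R k"
      have y1: "norm (f' y1 - f' x0 - f'' (y1 - x0)) \<le> (e / C) * (s * (norm h + norm k))"
      proof -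
        have *: "y1 - x0 = s *\<^sub>R h + \<tau> *\<^sub>R k" unfolding y1_def by simp
        have "norm (f' y1 - f' x0 - f'' (y1 - x0)) \<le> (e / C) * norm (y1 - x0)"
          by (rule d1(2)) (use near(2)[of s \<tau>] \<tau> s * in auto)
        also have "\<dots> \<le> (e / C) * (s * (norm h + norm k))"
          using near(1)[of s \<tau>] \<tau> s * \<open>e > 0\<close> C by (intro mult_left_mono) auto
        finally show ?thesis .
      qed
      have y0: "norm (f' y0 - f' x0 - f'' (y0 - x0)) \<le> (e / C) * (s * (norm h + norm k))"
      proof -
        have *: "y0 - x0 = 0 *\<^sub>R h + \<tau> *\<^sub>R k" unfolding y0_def by simp
        have "norm (f' y0 - f' x0 - f'' (y0 - x0)) \<le> (e / C) * norm (y0 - x0)"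
          by (rule d1(2)) (use near(2)[of 0 \<tau>] \<tau> s * in auto)
        also have "\<dots> \<le> (e / C) * (s * (norm h + norm k))"
          using near(1)[of 0 \<tau>] \<tau> s * \<open>e > 0\<close> C by (intro mult_left_mono) auto
        finally show ?thesis .
      qed
      have lin: "f'' (y1 - x0) - f'' (y0 - x0) = s *\<^sub>R f'' h"
      proof -
        have "f'' (y1 - x0) - f'' (y0 - x0) = f'' ((y1 - x0) - (y0 - x0))"
          using bounded_linear.linear[OF bl] linear_diff by metis
        also have "(y1 - x0) - (y0 - x0) = s *\<^sub>R h" unfolding y1_def y0_def by simp
        finally show ?thesis using bounded_linear.linear[OF bl] linear_scale by metis
      qed
      have "norm (f' y1 - f' y0 - s *\<^sub>R f'' h) \<le> 2 * ((e / C) * (s * (norm h + norm k)))"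
      proof -
        have eq: "f' y1 - f' y0 - s *\<^sub>R f'' h
            = (f' y1 - f' x0 - f'' (y1 - x0)) - (f' y0 - f' x0 - f'' (y0 - x0))"
          unfolding lin[symmetric] by simp
        show ?thesis
          unfolding eq using order_trans[OF norm_triangle_ineq4 add_mono[OF y1 y0]] by simp
      qed
      then have "\<bar>(f' y1 - f' y0 - s *\<^sub>R f'' h) k\<bar> \<le> 2 * ((e / C) * (s * (norm h + norm k))) * norm k"
        unfolding real_norm_def[symmetric]
        by (intro order_trans[OF norm_blinfun mult_right_mono[OF _ norm_ge_zero]])
      also have "\<dots> = (e / C) * s * (2 * (norm h + norm k) * norm k)" by (simp add: algebra_simps)
      also have "\<dots> \<le> (e / C) * s * C"
        using \<open>e > 0\<close> C s unfolding C_def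
        by (intro mult_left_mono) (auto simp: algebra_simps)
      also have "\<dots> = e * s" using C by simp
      finally have "\<bar>f' y1 k - f' y0 k - s * f'' h k\<bar> \<le> e * s"
        by (simp add: minus_blinfun.rep_eq scaleR_blinfun.rep_eq)
      then have "s * \<bar>f' y1 k - f' y0 k - s * f'' h k\<bar> \<le> s * (e * s)" using s by (intro mult_left_mono) auto
      moreover have "s * \<bar>f' y1 k - f' y0 k - s * f'' h k\<bar> = \<bar>s * (f' y1 k - f' y0 k - s * f'' h k)\<bar>"
        using s by (simp add: abs_mult)
      moreover have "s * (f' y1 k - f' y0 k - s * f'' h k) = \<phi> s - \<phi> 0 - s\<^sup>2 * f'' h k"
        unfolding eq y1_def y0_def by (simp add: algebra_simps power2_eq_square)
      moreover have "\<phi> s - \<phi> 0 = f (x0 + s *\<^sub>R h + s *\<^sub>R k) - f (x0 + s *\<^sub>R h) - f (x0 + s *\<^sub>R k) + f x0"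
        unfolding \<phi>_def by simp
      ultimately show ?thesis by (simp add: algebra_simps power2_eq_square)
    qed
    with \<open>d > 0\<close> show ?thesis by blast
  qed
  have "\<bar>f'' h k - f'' k h\<bar> \<le> e" if "e > 0" for e
  proof -
    have "e / 2 > 0" using that by simp
    obtain d1 where d1: "d1 > 0" "\<And>s. 0 < s \<Longrightarrow> s < d1 \<Longrightarrow>
      \<bar>f (x0 + s *\<^sub>R h + s *\<^sub>R k) - f (x0 + s *\<^sub>R h) - f (x0 + s *\<^sub>R k) + f x0 - s\<^sup>2 * f'' h k\<bar> \<le> (e/2) * s\<^sup>2"
      using main[OF \<open>e / 2 > 0\<close>, of h k] by blast
    obtain d2 where d2: "d2 > 0" "\<And>s. 0 < s \<Longrightarrow> s < d2 \<Longrightarrow>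
      \<bar>f (x0 + s *\<^sub>R k + s *\<^sub>R h) - f (x0 + s *\<^sub>R k) - f (x0 + s *\<^sub>R h) + f x0 - s\<^sup>2 * f'' k h\<bar> \<le> (e/2) * s\<^sup>2"
      using main[OF \<open>e / 2 > 0\<close>, of k h] by blast
    define s where "s = min d1 d2 / 2"
    have s: "0 < s" "s < d1" "s < d2" unfolding s_def using d1(1) d2(1) by auto
    have comm: "x0 + s *\<^sub>R k + s *\<^sub>R h = x0 + s *\<^sub>R h + s *\<^sub>R k" by simp
    have "\<bar>s\<^sup>2 * f'' h k - s\<^sup>2 * f'' k h\<bar> \<le> e * s\<^sup>2"
      using d1(2)[OF s(1,2)] d2(2)[OF s(1,3)] unfolding comm by linarith
    then have "s\<^sup>2 * \<bar>f'' h k - f'' k h\<bar> \<le> s\<^sup>2 * e"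
      by (metis abs_mult abs_of_nonneg mult.commute right_diff_distrib zero_le_power2)
    then show ?thesis using s(1) by simp
  qed
  then have "\<bar>f'' h k - f'' k h\<bar> \<le> 0" by (rule field_le_epsilon) simp
  then show ?thesis by simp
qed

text \<open>The scalar case, tested against the difference of the two sides.\<close>

lemma symmetric_second_derivative:
  fixes f :: "'a::real_normed_vector \<Rightarrow> 'b::real_inner"
  assumes "open U" "x0 \<in> U"
    and f': "\<And>x. x \<in> U \<Longrightarrow> (f has_derivative blinfun_apply (f' x)) (at x)"
    and f'': "(f' has_derivative f'') (at x0)"
  shows "blinfun_apply (f'' h) k = blinfun_apply (f'' k) h"
proof -
  define w where "w = f'' h k - f'' k h"
  have "blinfun_apply (blinfun_inner_left w o\<^sub>L f'' h) k = blinfun_apply (blinfun_inner_left w o\<^sub>L f'' k) h"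
  proof (rule symmetric_second_derivative_real[OF assms(1,2), where f = "\<lambda>x. f x \<bullet> w"
        and f' = "\<lambda>x. blinfun_inner_left w o\<^sub>L f' x"])
    show "((\<lambda>x. f x \<bullet> w) has_derivative blinfun_apply (blinfun_inner_left w o\<^sub>L f' x)) (at x)" if "x \<in> U" for x
      using has_derivative_inner_left[OF f'[OF that], of w]
      by (simp add: blinfun_compose.rep_eq blinfun_inner_left.rep_eq o_def)
    show "((\<lambda>x. blinfun_inner_left w o\<^sub>L f' x) has_derivative (\<lambda>h. blinfun_inner_left w o\<^sub>L f'' h)) (at x0)"
      by (rule bounded_linear.has_derivative[OF
            bounded_bilinear.bounded_linear_right[OF bounded_bilinear_blinfun_compose] f''])
  qed
  then have "w \<bullet> w = 0"
    unfolding w_def by (simp add: blinfun_inner_left.rep_eq inner_diff_left)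
  then show ?thesis by (simp add: w_def)
qed

text \<open>The Poincare lemma on a ball, by integration along rays. Symmetry of \<open>A'\<close> turns the derivative of the integrand
  into the derivative of \<open>t A(u\<^sub>0 + t (u - u\<^sub>0))\<close> with respect to \<open>t\<close>.\<close>

lemma closed_one_form_has_primitive:
  fixes A :: "'a::euclidean_space \<Rightarrow> 'a \<Rightarrow>\<^sub>L real"
  assumes A': "\<And>x. x \<in> ball u0 d \<Longrightarrow> (A has_derivative blinfun_apply (A' x)) (at x)"
    and cont: "continuous_on (ball u0 d) A'"
    and sym: "\<And>x h k. x \<in> ball u0 d \<Longrightarrow> A' x h k = A' x k h"
  shows "\<exists>\<rho>. \<rho> u0 = c \<and> (\<forall>u\<in>ball u0 d. (\<rho> has_derivative blinfun_apply (A u)) (at u))"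
proof -
  define f where "f u t = A (u0 + t *\<^sub>R (u - u0)) (u - u0)" for u and t :: real
  define fx where "fx u t = t *\<^sub>R A' (u0 + t *\<^sub>R (u - u0)) (u - u0) + A (u0 + t *\<^sub>R (u - u0))" for u and t :: real
  have seg: "u0 + t *\<^sub>R (u - u0) \<in> ball u0 d" if "u \<in> ball u0 d" "t \<in> cbox 0 1" for u and t :: real
  proof -
    have "norm (t *\<^sub>R (u - u0)) \<le> norm (u - u0)"
      using that(2) by (simp add: mult_left_le_one_le)
    then show ?thesis using that(1) by (simp add: dist_norm norm_minus_commute)
  qed
  have contA: "continuous_on (ball u0 d) A"
    using A' by (meson has_derivative_at_withinI has_derivative_continuous_on)
  have fx: "((\<lambda>u. f u t) has_derivative blinfun_apply (fx u t)) (at u within ball u0 d)"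
    if "u \<in> ball u0 d" "t \<in> cbox 0 1" for u t
  proof -
    have 1: "((\<lambda>u. A (u0 + t *\<^sub>R (u - u0))) has_derivative
        (\<lambda>h. A' (u0 + t *\<^sub>R (u - u0)) (t *\<^sub>R h))) (at u within ball u0 d)"
      by (rule has_derivative_compose[where f = "\<lambda>u. u0 + t *\<^sub>R (u - u0)" and g = A, OF _ A'[OF seg[OF that]]]) (auto intro!: derivative_eq_intros)
    have "((\<lambda>u. f u t) has_derivative (\<lambda>h. A (u0 + t *\<^sub>R (u - u0)) h
        + A' (u0 + t *\<^sub>R (u - u0)) (t *\<^sub>R h) (u - u0))) (at u within ball u0 d)"
      unfolding f_def by (rule blinfun.FDERIV[OF 1]) (auto intro!: derivative_eq_intros)
    then show ?thesis
      by (rule has_derivative_eq_rhs)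
        (auto simp: fx_def fun_eq_iff plus_blinfun.rep_eq scaleR_blinfun.rep_eq
          blinfun.scaleR_right sym[OF seg[OF that], of _ "u - u0"])
  qed
  have contf: "continuous_on (ball u0 d \<times> cbox 0 1) (\<lambda>(u, t). fx u t)"
    unfolding fx_def case_prod_beta
    by (intro continuous_intros continuous_on_compose2[OF cont] continuous_on_compose2[OF contA])
      (use seg in auto)
  have deriv: "((\<lambda>u. integral (cbox 0 1) (f u)) has_derivative integral (cbox 0 1) (fx u))
      (at u within ball u0 d)" if "u \<in> ball u0 d" for u
  proof (rule leibniz_rule[OF fx _ contf that])
    show "f x integrable_on cbox 0 1" if "x \<in> ball u0 d" for x
      unfolding f_def
      by (intro integrable_continuous continuous_intros continuous_on_compose2[OF contA])
        (use seg[OF that] in auto)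
  qed auto
  have int: "(fx u has_integral A u) (cbox 0 1)" if "u \<in> ball u0 d" for u
  proof -
    have "((\<lambda>t. t *\<^sub>R A (u0 + t *\<^sub>R (u - u0))) has_vector_derivative fx u t) (at t within {0..1})"
      if "t \<in> {0..1}" for t
    proof -
      have "((\<lambda>t. A (u0 + t *\<^sub>R (u - u0))) has_derivative
          (\<lambda>\<tau>. A' (u0 + t *\<^sub>R (u - u0)) (\<tau> *\<^sub>R (u - u0)))) (at t within {0..1})"
        by (rule has_derivative_compose[where f = "\<lambda>t. u0 + t *\<^sub>R (u - u0)" and g = A, OF _ A'[OF seg]])
          (use \<open>u \<in> ball u0 d\<close> that in \<open>auto intro!: derivative_eq_intros\<close>)
      then have "((\<lambda>t. A (u0 + t *\<^sub>R (u - u0))) has_vector_derivative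
          A' (u0 + t *\<^sub>R (u - u0)) (u - u0)) (at t within {0..1})"
        by (simp add: has_vector_derivative_def blinfun.scaleR_right)
      from has_vector_derivative_scaleR[OF DERIV_ident this] show ?thesis
        by (simp add: fx_def)
    qed
    from fundamental_theorem_of_calculus[OF _ this] show ?thesis by simp
  qed
  show ?thesis
  proof (intro exI conjI ballI)
    let ?\<rho> = "\<lambda>u. c + integral (cbox 0 1) (f u)"
    have "f u0 = (\<lambda>t. 0)" by (simp add: f_def fun_eq_iff)
    then show "?\<rho> u0 = c" by simp
    show "(?\<rho> has_derivative blinfun_apply (A u)) (at u)" if "u \<in> ball u0 d" for u
    proof -
      have "((\<lambda>u. integral (cbox 0 1) (f u)) has_derivative blinfun_apply (A u)) (at u)"
        using deriv[OF that] that unfolding integral_unique[OF int[OF that]]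
        by (simp add: at_within_open[OF _ open_ball])
      then show ?thesis by (auto intro!: derivative_eq_intros)
    qed
  qed
qed

section \<open>Immersions and their images\<close>

lemma has_derivative_linear_approx:
  assumes "(f has_derivative f') (at x)" "e > 0"
  shows "\<exists>d>0. \<forall>y. norm (y - x) < d \<longrightarrow> norm (f y - f x - f' (y - x)) \<le> e * norm (y - x)"
  using assms unfolding has_derivative_at_alt by blast

lemma inj_derivative_lower_bound:
  fixes f :: "'a::euclidean_space \<Rightarrow> 'b::euclidean_space"
  assumes "(f has_derivative f') (at q)" "inj f'"
  shows "\<exists>B>0. \<exists>d>0. \<forall>u. norm (u - q) < d \<longrightarrow> B * norm (u - q) \<le> norm (f u - f q)"
proof -
  have lin: "linear f'" using assms(1) has_derivative_linear by blast
  obtain B where B: "B > 0" "\<And>x. B * norm x \<le> norm (f' x)"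
    using linear_inj_bounded_below_pos[OF lin assms(2)] by blast
  obtain d where d: "d > 0" "\<And>u. norm (u - q) < d \<Longrightarrow>
      norm (f u - f q - f' (u - q)) \<le> (B/2) * norm (u - q)"
    using assms(1) B(1) unfolding has_derivative_at_alt by (metis half_gt_zero)
  have "(B/2) * norm (u - q) \<le> norm (f u - f q)" if "norm (u - q) < d" for u
    using d(2)[OF that] B(2)[of "u - q"] norm_triangle_ineq4[of "f u - f q" "f u - f q - f' (u - q)"]
    by (simp add: norm_minus_commute)
  then show ?thesis using B(1) d(1) by (meson half_gt_zero)
qed

text \<open>Tangent vectors of the image of an immersion are tangent to the parametrisation; this is expressed
  through functionals, which is how orthogonality uses it. A tangent vector comes from a
  curve in the image that is differentiable at one point only. The lower bound for immersions
  gives \<open>u s - q = O(s)\<close> for its lift \<open>u\<close> to the parameter domain, and \<open>l \<circ> X\<close> is stationary at \<open>q\<close>,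
  so \<open>l\<close> changes along the curve by \<open>o(s)\<close>.\<close>

lemma tangent_space_image_immersion:
  fixes X :: "real^2 \<Rightarrow> real \<times> complex"
  assumes hom: "homeomorphism U S X Y" and "q \<in> U"
    and X': "(X has_derivative X') (at q)" "inj X'"
    and v: "v \<in> tangent_space S (X q)"
    and l: "bounded_linear l" "\<And>h. l (X' h) = 0"
  shows "l v = (0::real)"
proof -
  obtain c \<epsilon> where c: "\<epsilon> > 0" "\<And>s. \<bar>s\<bar> < \<epsilon> \<Longrightarrow> c s \<in> S" "c 0 = X q"
    "(c has_vector_derivative v) (at 0)"
    using v unfolding tangent_space_def by blast
  obtain B d where B: "B > 0" "d > 0" "\<And>u. norm (u - q) < d \<Longrightarrow> B * norm (u - q) \<le> norm (X u - X q)"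
    using inj_derivative_lower_bound[OF X'] by blast
  define u where "u s = Y (c s)" for s
  have Xu: "X (u s) = c s" if "\<bar>s\<bar> < \<epsilon>" for s
    unfolding u_def using homeomorphism_apply2[OF hom] c(2) that by blast
  have u0: "u 0 = q" unfolding u_def c(3) by (rule homeomorphism_apply1[OF hom \<open>q \<in> U\<close>])
  have c_lim: "(c \<longlongrightarrow> X q) (at 0)"
    using has_vector_derivative_continuous[OF c(4)] c(3) by (simp add: continuous_at)
  have ev: "\<forall>\<^sub>F s in at 0. \<bar>s\<bar> < \<epsilon>"
    unfolding eventually_at using c(1) by (auto intro!: exI[of _ \<epsilon>])
  have u_lim: "(u \<longlongrightarrow> q) (at 0)"
  proof -
    have "X q \<in> S" using c(1) c(2)[of 0] c(3) by simp
    moreover have "\<forall>\<^sub>F s in at 0. c s \<in> S" using ev by eventually_elim (rule c(2))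
    ultimately have "((\<lambda>s. Y (c s)) \<longlongrightarrow> Y (X q)) (at 0)"
      using continuous_on_tendsto_compose[OF homeomorphism_cont2[OF hom] c_lim] by blast
    then show ?thesis using u0 c(3) unfolding u_def by simp
  qed
  have "\<bar>l v\<bar> \<le> 2 * e" if e: "e > 0" for e
  proof -
    define e' where "e' = e * B / (norm v + 1)"
    have nv: "norm v + 1 > 0" by (simp add: add_nonneg_pos)
    have "e' > 0" unfolding e'_def using e B(1) nv by simp
    have lX: "((\<lambda>u. l (X u)) has_derivative (\<lambda>h. 0)) (at q)"
      using bounded_linear.has_derivative[OF l(1) X'(1)] l(2) by simp
    obtain d2 where d2: "d2 > 0" "\<And>u. norm (u - q) < d2 \<Longrightarrow> norm (l (X u) - l (X q)) \<le> e' * norm (u - q)"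
      using has_derivative_linear_approx[OF lX \<open>e' > 0\<close>] by auto
    have c': "(c has_derivative (\<lambda>s. s *\<^sub>R v)) (at 0)"
      using c(4) by (simp add: has_vector_derivative_def)
    obtain d3 where d3: "d3 > 0" "\<And>s. norm (s - 0) < d3 \<Longrightarrow> norm (c s - c 0 - (s - 0) *\<^sub>R v) \<le> 1 * norm (s - 0)"
      using has_derivative_linear_approx[OF c' zero_less_one] by auto
    have lc: "((\<lambda>s. l (c s)) has_derivative (\<lambda>s. l (s *\<^sub>R v))) (at 0)"
      by (rule bounded_linear.has_derivative[OF l(1) c'])
    obtain d4 where d4: "d4 > 0" "\<And>s. norm (s - 0) < d4 \<Longrightarrow>
        norm (l (c s) - l (c 0) - l ((s - 0) *\<^sub>R v)) \<le> e * norm (s - 0)"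
      using has_derivative_linear_approx[OF lc e] by auto
    have "\<forall>\<^sub>F s in at 0. norm (u s - q) < min d d2"
      using tendstoD[OF u_lim, of "min d d2"] B(2) d2(1) by (simp add: dist_norm)
    moreover have "\<forall>\<^sub>F s in at 0. \<bar>s\<bar> < min d3 d4 \<and> s \<noteq> 0"
      unfolding eventually_at using d3(1) d4(1) by (auto intro!: exI[of _ "min d3 d4"])
    ultimately have "\<forall>\<^sub>F s in at 0. norm (u s - q) < min d d2 \<and> \<bar>s\<bar> < min d3 d4 \<and> s \<noteq> 0 \<and> \<bar>s\<bar> < \<epsilon>"
      using ev by eventually_elim auto
    then obtain s where s: "norm (u s - q) < d" "norm (u s - q) < d2" "\<bar>s\<bar> < d3" "\<bar>s\<bar> < d4" "s \<noteq> 0" "\<bar>s\<bar> < \<epsilon>"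
      using eventually_happens'[OF at_neq_bot] by force
    have "norm (c s - c 0) \<le> (norm v + 1) * \<bar>s\<bar>"
      using d3(2)[of s] s(3) norm_triangle_ineq2[of "c s - c 0" "s *\<^sub>R v"] by (simp add: algebra_simps)
    then have "B * norm (u s - q) \<le> (norm v + 1) * \<bar>s\<bar>"
      using B(3)[OF s(1)] Xu[OF s(6)] c(3) by simp
    then have "e' * norm (u s - q) \<le> e * \<bar>s\<bar>"
      unfolding e'_def using nv B(1) \<open>e > 0\<close> by (simp add: divide_simps mult.assoc mult.commute[of _ "norm v + 1"])
    then have "\<bar>l (c s) - l (c 0)\<bar> \<le> e * \<bar>s\<bar>"
      using d2(2)[OF s(2)] Xu[OF s(6)] c(3) by simp
    then have "\<bar>l (s *\<^sub>R v)\<bar> \<le> 2 * e * \<bar>s\<bar>" using d4(2)[of s] s(4) by simp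
    then show ?thesis using s(5) by (simp add: linear_cmul[OF bounded_linear.linear[OF l(1)]] abs_mult mult.commute)
  qed
  from this[of "e / 2" for e] have "\<bar>l v\<bar> \<le> 0 + e" if "e > 0" for e using that by simp
  then have "\<bar>l v\<bar> \<le> 0" by (rule field_le_epsilon)
  then show ?thesis by simp
qed

text \<open>Injectivity of the derivative is an open condition, so the neighbourhood on which the map is
  injective can also be chosen to consist of immersed points.\<close>

lemma C1_immersion_locally_injective:
  fixes F :: "'a::euclidean_space \<Rightarrow> 'b::euclidean_space"
  assumes C1: "C1_on S F" and S: "open S" "a \<in> S"
    and F0: "(F has_derivative F0) (at a)" "inj F0"
  shows "\<exists>r>0. ball a r \<subseteq> S \<and> inj_on F (ball a r) \<and>
    (\<forall>x\<in>ball a r. \<forall>D. (F has_derivative D) (at x) \<longrightarrow> inj D)"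
proof -
  obtain F' where F': "\<And>x. x \<in> S \<Longrightarrow> (F has_derivative blinfun_apply (F' x)) (at x)"
    and cont: "continuous_on S F'"
    using C1 unfolding C1_on_def by blast
  have F0_eq: "F0 = blinfun_apply (F' a)"
    using has_derivative_unique[OF F0(1) F'[OF S(2)]] .
  have lin: "linear F0" using F0(1) has_derivative_linear by blast
  obtain g' where g': "linear g'" "g' \<circ> F0 = id"
    using linear_injective_left_inverse[OF lin F0(2)] by blast
  have near: "\<exists>d>0. ball a d \<subseteq> S \<and> (\<forall>x. dist a x < d \<longrightarrow> norm (F' x - F' a) < e)" if e: "e > 0" for e
  proof -
    obtain d0 where d0: "d0 > 0" "ball a d0 \<subseteq> S" using S open_contains_ball by blast
    obtain d1 where d1: "d1 > 0" "\<And>x. x \<in> S \<Longrightarrow> dist x a < d1 \<Longrightarrow> dist (F' x) (F' a) < e"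
      using cont S(2) e unfolding continuous_on_iff by blast
    have "norm (F' x - F' a) < e" if "dist a x < min d0 d1" for x
      using d1(2)[of x] d0(2) that by (auto simp: dist_commute dist_norm[symmetric] subset_iff)
    moreover have "ball a (min d0 d1) \<subseteq> S" using d0(2) by auto
    ultimately show ?thesis using d0(1) d1(1) by (intro exI[of _ "min d0 d1"]) auto
  qed
  obtain r where r: "r > 0" "ball a r \<subseteq> S" "inj_on F (ball a r)"
  proof (rule has_derivative_locally_injective[of a S g' "\<lambda>x. blinfun_apply (F' x)" F])
    show "\<exists>d>0. \<forall>x. dist a x < d \<longrightarrow> onorm (\<lambda>v. F' x v - F' a v) < e" if "e > 0" for e
      using near[OF that] by (auto simp: norm_blinfun.rep_eq minus_blinfun.rep_eq)
  qed (use S g' F' F0_eq linear_conv_bounded_linear in auto)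
  obtain B where B: "B > 0" "\<And>x. B * norm x \<le> norm (F0 x)"
    using linear_inj_bounded_below_pos[OF lin F0(2)] by blast
  obtain d where d: "d > 0" "ball a d \<subseteq> S" "\<And>x. dist a x < d \<Longrightarrow> norm (F' x - F' a) < B"
    using near[OF B(1)] by blast
  have "inj D" if "x \<in> ball a d" "(F has_derivative D) (at x)" for x D
  proof -
    have D: "D = blinfun_apply (F' x)" using has_derivative_unique[OF that(2) F'] that(1) d(2) by blast
    have "h = 0" if "D h = 0" for h
    proof (rule ccontr)
      assume "h \<noteq> 0"
      have "norm (F0 h) = norm ((F' x - F' a) h)"
        using that D F0_eq by (simp add: minus_blinfun.rep_eq)
      also have "\<dots> \<le> norm (F' x - F' a) * norm h" by (rule norm_blinfun)
      also have "\<dots> < B * norm h" using d(3)[of x] \<open>x \<in> ball a d\<close> \<open>h \<noteq> 0\<close> by simp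
      finally show False using B(2)[of h] by simp
    qed
    then show ?thesis
      using has_derivative_linear[OF that(2)] linear_injective_0 by blast
  qed
  then show ?thesis using r d(1)
    by (intro exI[of _ "min r d"]) (auto intro: inj_on_subset)
qed

text \<open>The slightly larger radius puts the closed ball into the domain of injectivity, so
  that compactness makes the inverse continuous.\<close>

lemma homeomorphism_onto_image_ball:
  fixes X :: "'a::euclidean_space \<Rightarrow> 'b::euclidean_space"
  assumes "continuous_on (ball u r) X" "inj_on X (ball u r)" "\<epsilon> < r"
  shows "\<exists>Y. homeomorphism (ball u \<epsilon>) (X ` ball u \<epsilon>) X Y"
proof -
  have sub: "cball u \<epsilon> \<subseteq> ball u r" using assms(3) by auto
  obtain Y where "homeomorphism (cball u \<epsilon>) (X ` cball u \<epsilon>) X Y"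
    using homeomorphism_compact[OF compact_cball continuous_on_subset[OF assms(1) sub] refl
        inj_on_subset[OF assms(2) sub]] by blast
  then have "homeomorphism (ball u \<epsilon>) (X ` ball u \<epsilon>) X Y"
    by (rule homeomorphism_of_subsets) auto
  then show ?thesis by blast
qed

section \<open>Geodesics parametrised by a Busemann function\<close>

definition height :: "complex \<times> complex \<Rightarrow> real \<Rightarrow> real" where
  "height p r = exp r / (1 + (norm (snd p))\<^sup>2 * (exp r)\<^sup>2)"

text \<open>The geodesic from the boundary point \<open>a = fst p\<close> to \<open>a + b / |b|\<^sup>2\<close> with \<open>b = snd p\<close>, which is \<open>\<infinity>\<close> for \<open>b = 0\<close>.
  The parameter is arc length, and parameter \<open>r\<close> lies on the horosphere at \<open>a\<close> on which \<open>busemann a\<close> equals \<open>r\<close>;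
  unlike the usual normalisation at the highest point, this one is smooth across the
  vertical half-lines \<open>b = 0\<close>.\<close>

definition horo_geodesic :: "complex \<times> complex \<Rightarrow> real \<Rightarrow> real \<times> complex" where
  "horo_geodesic p r = (height p r, fst p + (exp r * height p r) *\<^sub>R snd p)"

definition busemann :: "complex \<Rightarrow> real \<times> complex \<Rightarrow> real" where
  "busemann a x = ln ((fst x)\<^sup>2 + (norm (snd x - a))\<^sup>2) - ln (fst x)"

definition velocity :: "complex \<times> complex \<Rightarrow> real \<Rightarrow> real \<times> complex" where
  "velocity p r = (2 * (height p r)\<^sup>2 * exp (- r) - height p r, (2 * (height p r)\<^sup>2) *\<^sub>R snd p)"

lemma denominator_pos: "1 + (norm b)\<^sup>2 * (exp r)\<^sup>2 > (0::real)"
  by (meson add_pos_nonneg mult_nonneg_nonneg zero_le_power2 zero_less_one)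

lemma height_pos: "height p r > 0"
  unfolding height_def by (intro divide_pos_pos denominator_pos) simp

lemma height_mult_denominator: "height p r * (1 + (norm (snd p))\<^sup>2 * (exp r)\<^sup>2) = exp r"
  unfolding height_def using denominator_pos[of "snd p" r] by (metis less_irrefl nonzero_eq_divide_eq)

lemma inverse_height: "1 / height p r = exp (- r) + (norm (snd p))\<^sup>2 * exp r"
  unfolding height_def by (simp add: exp_minus field_simps power2_eq_square)

text \<open>The quantity \<open>t\<^sup>2 + |z - a|\<^sup>2\<close> is the numerator under the logarithm in the Busemann function and the
  denominator in the recovery of \<open>b\<close> from a point of the geodesic.\<close>

lemma euclidean_dist_horo_geodesic:
  "(fst (horo_geodesic p r))\<^sup>2 + (norm (snd (horo_geodesic p r) - fst p))\<^sup>2 = height p r * exp r"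
proof -
  have "(height p r)\<^sup>2 * (1 + (norm (snd p))\<^sup>2 * (exp r)\<^sup>2) = height p r * exp r"
    using height_mult_denominator[of p r] by (metis mult.assoc power2_eq_square)
  then show ?thesis
    by (simp add: horo_geodesic_def power_mult_distrib abs_mult algebra_simps)
qed

lemma busemann_horo_geodesic: "busemann (fst p) (horo_geodesic p r) = r"
  unfolding busemann_def euclidean_dist_horo_geodesic using height_pos[of p r]
  by (simp add: horo_geodesic_def ln_mult)

lemma horo_geodesic_in_H3: "horo_geodesic p r \<in> H3"
  using height_pos by (simp add: H3_def horo_geodesic_def)

lemma height_has_derivative:
  "(height p has_real_derivative (2 * (height p r)\<^sup>2 * exp (- r) - height p r)) (at r)"
proof -
  define D where "D = 1 + (norm (snd p))\<^sup>2 * (exp r)\<^sup>2"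
  have D: "D \<noteq> 0" using denominator_pos[of "snd p" r] by (simp add: D_def)
  have D1: "(norm (snd p))\<^sup>2 * (exp r * exp r) = D - 1" by (simp add: D_def power2_eq_square)
  have "(height p has_real_derivative
      (exp r * D - exp r * ((norm (snd p))\<^sup>2 * (2 * exp r * exp r))) / (D * D)) (at r)"
    unfolding height_def[abs_def] D_def
    by (rule derivative_eq_intros refl | use D in \<open>simp add: D_def power2_eq_square; fail\<close>)+
  moreover have "exp r * D - exp r * ((norm (snd p))\<^sup>2 * (2 * exp r * exp r)) = exp r * (2 - D)"
    using arg_cong[OF D1, of "\<lambda>x. 2 * exp r * x"] by (simp add: algebra_simps)
  moreover have "exp r * (2 - D) / (D * D) = 2 * (height p r)\<^sup>2 * exp (- r) - height p r"
    unfolding height_def exp_minus D_def[symmetric] using D by (simp add: field_simps power2_eq_square)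
  ultimately show ?thesis by simp
qed

lemma horo_geodesic_has_velocity: "(horo_geodesic p has_vector_derivative velocity p r) (at r)"
proof -
  have 1: "(height p has_vector_derivative (2 * (height p r)\<^sup>2 * exp (- r) - height p r)) (at r)"
    using height_has_derivative by (simp add: has_real_derivative_iff_has_vector_derivative)
  have 2: "((\<lambda>r. exp r * height p r) has_real_derivative 2 * (height p r)\<^sup>2) (at r)"
    by (rule derivative_eq_intros DERIV_exp height_has_derivative refl)+
       (simp add: exp_minus field_simps)
  have 3: "((\<lambda>r. fst p + (exp r * height p r) *\<^sub>R snd p) has_vector_derivative (2 * (height p r)\<^sup>2) *\<^sub>R snd p) (at r)"
    using has_vector_derivative_add[OF has_vector_derivative_const
      has_vector_derivative_scaleR[OF 2 has_vector_derivative_const]] by simp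
  from has_vector_derivative_Pair[OF 1 3] show ?thesis
    unfolding horo_geodesic_def[abs_def] velocity_def by simp
qed

lemma hyp_metric_velocity:
  "hyp_metric (horo_geodesic p r) v (velocity p r) =
     fst v * (2 * exp (- r) - 1 / height p r) + 2 * (snd p \<bullet> snd v)"
  using height_pos[of p r]
  by (simp add: hyp_metric_def horo_geodesic_def velocity_def inner_complex_def field_simps power2_eq_square)

lemma bounded_linear_hyp_metric: "bounded_linear (\<lambda>v. hyp_metric x v w)"
  unfolding hyp_metric_def
  by (intro bounded_linear_divide[THEN bounded_linear_compose] bounded_linear_add
      bounded_linear_mult_left[THEN bounded_linear_compose] bounded_linear_fst
      bounded_linear_Re[THEN bounded_linear_compose] bounded_linear_Im[THEN bounded_linear_compose]
      bounded_linear_snd)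

text \<open>The derivative at a point of the geodesic. Its part in the direction of the point says that
  the velocity is the hyperbolic gradient of the Busemann function.\<close>

lemma busemann_has_derivative:
  "((\<lambda>y. busemann (fst y) (snd y)) has_derivative
     (\<lambda>\<delta>. hyp_metric (horo_geodesic p r) (snd \<delta>) (velocity p r) - 2 * (snd p \<bullet> fst \<delta>))) (at (fst p, horo_geodesic p r))"
proof -
  have h: "height p r > 0" by (rule height_pos)
  let ?x = "horo_geodesic p r"
  have N: "fst ?x * fst ?x + (snd ?x - fst p) \<bullet> (snd ?x - fst p) = height p r * exp r"
    using euclidean_dist_horo_geodesic[of p r] by (simp add: power2_eq_square power2_norm_eq_inner[symmetric])
  have N0: "fst ?x * fst ?x + (snd ?x - fst p) \<bullet> (snd ?x - fst p) > 0" unfolding N using h by simp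
  have t: "fst ?x = height p r" by (simp add: horo_geodesic_def)
  have z: "snd ?x - fst p = (exp r * height p r) *\<^sub>R snd p" by (simp add: horo_geodesic_def)
  have "((\<lambda>y. busemann (fst y) (snd y)) has_derivative
     (\<lambda>\<delta>. (2 * fst ?x * fst (snd \<delta>) + 2 * ((snd ?x - fst p) \<bullet> (snd (snd \<delta>) - fst \<delta>)))
          / (fst ?x * fst ?x + (snd ?x - fst p) \<bullet> (snd ?x - fst p)) - fst (snd \<delta>) / fst ?x))
     (at (fst p, ?x))"
    unfolding busemann_def power2_norm_eq_inner power2_eq_square[of "fst _"]
    by (rule derivative_eq_intros refl | use N0 h t in \<open>simp; fail\<close>)+
      (auto simp: fun_eq_iff inner_commute divide_inverse algebra_simps)
  then show ?thesis
    unfolding N unfolding t z hyp_metric_velocity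
    by (rule has_derivative_eq_rhs)
      (use h in \<open>simp add: fun_eq_iff exp_minus inner_diff_right field_simps\<close>)
qed

text \<open>Differentiate the identity \<open>busemann (fst (g u)) (horo_geodesic (g u) (\<rho> u)) = \<rho> u\<close>.\<close>

lemma first_variation:
  assumes g: "(g has_derivative g') (at u)" and X: "((\<lambda>u. horo_geodesic (g u) (\<rho> u)) has_derivative X') (at u)"
    and \<rho>: "(\<rho> has_derivative \<rho>') (at u)"
  shows "hyp_metric (horo_geodesic (g u) (\<rho> u)) (X' h) (velocity (g u) (\<rho> u)) = \<rho>' h + 2 * (snd (g u) \<bullet> fst (g' h))"
proof -
  have "((\<lambda>u. (fst (g u), horo_geodesic (g u) (\<rho> u))) has_derivative (\<lambda>h. (fst (g' h), X' h))) (at u)"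
    by (intro has_derivative_Pair has_derivative_fst g X)
  from has_derivative_compose[OF this busemann_has_derivative]
  have "(\<rho> has_derivative (\<lambda>h. hyp_metric (horo_geodesic (g u) (\<rho> u)) (X' h) (velocity (g u) (\<rho> u))
      - 2 * (snd (g u) \<bullet> fst (g' h)))) (at u)"
    by (simp add: busemann_horo_geodesic)
  from has_derivative_unique[OF this \<rho>] show ?thesis by (metis diff_add_cancel)
qed

text \<open>Recovers the coordinate \<open>b\<close> of the geodesic that starts at \<open>a\<close> and passes through \<open>x\<close>.\<close>

definition endpoint_covector :: "complex \<Rightarrow> real \<times> complex \<Rightarrow> complex" where
  "endpoint_covector a x = (snd x - a) /\<^sub>R ((fst x)\<^sup>2 + (norm (snd x - a))\<^sup>2)"

lemma endpoint_covector_horo_geodesic: "endpoint_covector (fst p) (horo_geodesic p r) = snd p"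
  unfolding endpoint_covector_def euclidean_dist_horo_geodesic using height_pos[of p r]
  by (simp add: horo_geodesic_def field_simps)

lemma endpoint_covector_has_derivative:
  "((\<lambda>y. endpoint_covector (fst y) (snd y)) has_derivative
     (\<lambda>\<delta>. (snd (snd \<delta>) - fst \<delta>) /\<^sub>R (height p r * exp r)
        - (2 * exp (- r) * fst (snd \<delta>) + 2 * (snd p \<bullet> (snd (snd \<delta>) - fst \<delta>))) *\<^sub>R snd p))
    (at (fst p, horo_geodesic p r))"
proof -
  have h: "height p r > 0" by (rule height_pos)
  let ?x = "horo_geodesic p r"
  have N: "fst ?x * fst ?x + (snd ?x - fst p) \<bullet> (snd ?x - fst p) = height p r * exp r"
    using euclidean_dist_horo_geodesic[of p r] by (simp add: power2_eq_square power2_norm_eq_inner[symmetric])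
  have N0: "fst ?x * fst ?x + (snd ?x - fst p) \<bullet> (snd ?x - fst p) \<noteq> 0" unfolding N using h by simp
  have t: "fst ?x = height p r" by (simp add: horo_geodesic_def)
  have z: "snd ?x - fst p = (exp r * height p r) *\<^sub>R snd p" by (simp add: horo_geodesic_def)
  let ?N = "fst ?x * fst ?x + (snd ?x - fst p) \<bullet> (snd ?x - fst p)"
  have "((\<lambda>y. endpoint_covector (fst y) (snd y)) has_derivative
     (\<lambda>\<delta>. inverse ?N *\<^sub>R (snd (snd \<delta>) - fst \<delta>) +
        (- (inverse ?N * (2 * fst ?x * fst (snd \<delta>) + 2 * ((snd ?x - fst p) \<bullet> (snd (snd \<delta>) - fst \<delta>))) * inverse ?N))
          *\<^sub>R (snd ?x - fst p))) (at (fst p, ?x))"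
    unfolding endpoint_covector_def power2_norm_eq_inner power2_eq_square[of "fst _"]
    by (rule derivative_eq_intros refl | use N0 in \<open>simp; fail\<close>)+
      (auto simp: fun_eq_iff inner_commute algebra_simps)
  then show ?thesis
    unfolding N unfolding t z
    by (rule has_derivative_eq_rhs)
      (use h in \<open>simp add: fun_eq_iff exp_minus field_simps\<close>)
qed

text \<open>The equation of focal points: a variation of the geodesic that fixes a point to first order is determined by the
  variation of its initial end point, since \<open>b\<close> and the parameter are functions of that end point and the fixed point.\<close>

lemma horo_geodesic_derivative_kernel:
  assumes E: "((\<lambda>q. horo_geodesic (fst q) (snd q)) has_derivative E') (at (p, r))"
    and zero: "E' \<delta> = 0"
  shows "snd (fst \<delta>) = (2 * (snd p \<bullet> fst (fst \<delta>))) *\<^sub>R snd p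
           - (exp (- r) * exp (- r) + (norm (snd p))\<^sup>2) *\<^sub>R fst (fst \<delta>)"
    and "snd \<delta> = - 2 * (snd p \<bullet> fst (fst \<delta>))"
proof -
  have "hyp_metric (horo_geodesic p r) (E' \<delta>) (velocity p r) = snd \<delta> + 2 * (snd p \<bullet> fst (fst \<delta>))"
    using first_variation[where g = fst and \<rho> = snd and u = "(p, r)", OF _ E]
    by (metis bounded_linear_fst bounded_linear_snd bounded_linear_imp_has_derivative fst_conv snd_conv)
  then show "snd \<delta> = - 2 * (snd p \<bullet> fst (fst \<delta>))"
    by (simp add: zero hyp_metric_def)
  have "((\<lambda>q. (fst (fst q), horo_geodesic (fst q) (snd q))) has_derivative (\<lambda>\<delta>. (fst (fst \<delta>), E' \<delta>))) (at (p, r))"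
    by (intro has_derivative_Pair has_derivative_fst has_derivative_ident E)
  note has_derivative_compose[OF this, unfolded fst_conv snd_conv, OF endpoint_covector_has_derivative]
  then have "((\<lambda>q. snd (fst q)) has_derivative
     (\<lambda>\<delta>. (snd (E' \<delta>) - fst (fst \<delta>)) /\<^sub>R (height p r * exp r)
        - (2 * exp (- r) * fst (E' \<delta>) + 2 * (snd p \<bullet> (snd (E' \<delta>) - fst (fst \<delta>)))) *\<^sub>R snd p)) (at (p, r))"
    by (simp add: endpoint_covector_horo_geodesic)
  moreover have "((\<lambda>q. snd (fst q)) has_derivative (\<lambda>\<delta>. snd (fst \<delta>))) (at (p, r))"
    by (intro has_derivative_snd has_derivative_fst has_derivative_ident)
  ultimately have "snd (fst \<delta>) = (snd (E' \<delta>) - fst (fst \<delta>)) /\<^sub>R (height p r * exp r)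
        - (2 * exp (- r) * fst (E' \<delta>) + 2 * (snd p \<bullet> (snd (E' \<delta>) - fst (fst \<delta>)))) *\<^sub>R snd p"
    using has_derivative_unique by (metis (no_types, lifting))
  moreover have "inverse (height p r * exp r) = exp (- r) * exp (- r) + (norm (snd p))\<^sup>2"
    using inverse_height[of p r] by (simp add: divide_inverse exp_minus algebra_simps)
  ultimately show "snd (fst \<delta>) = (2 * (snd p \<bullet> fst (fst \<delta>))) *\<^sub>R snd p
           - (exp (- r) * exp (- r) + (norm (snd p))\<^sup>2) *\<^sub>R fst (fst \<delta>)"
    by (simp add: zero)
qed

lemma C2_on_horo_geodesic: "C2_on U (\<lambda>q. horo_geodesic (fst q) (snd q))"
  unfolding horo_geodesic_def height_def power2_norm_eq_inner power2_eq_square[of "exp _"]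
  by (intro C2_on_intros) (metis denominator_pos power2_norm_eq_inner power2_eq_square less_irrefl)+

section \<open>The canonical symplectic form and focal points\<close>

text \<open>The form \<open>db \<and> da\<close> in the coordinates \<open>(a, b)\<close>.\<close>

definition canonical_symplectic :: "complex \<times> complex \<Rightarrow> complex \<times> complex \<Rightarrow> real" where
  "canonical_symplectic p q = snd p \<bullet> fst q - snd q \<bullet> fst p"

text \<open>The pullback of \<open>-2 b \<bullet> da\<close> under \<open>g\<close>, where \<open>g'\<close> stands for the derivative of \<open>g\<close>.
  A function \<open>\<rho>\<close> with this differential places the points at parameter \<open>\<rho>\<close> orthogonally to the geodesics.\<close>

definition action_form :: "(real^2 \<Rightarrow> complex \<times> complex) \<Rightarrow>
    (real^2 \<Rightarrow> (real^2) \<Rightarrow>\<^sub>L (complex \<times> complex)) \<Rightarrow> real^2 \<Rightarrow> (real^2) \<Rightarrow>\<^sub>L real" where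
  "action_form g g' u = (-2) *\<^sub>R (blinfun_inner_right (snd (g u)) o\<^sub>L (fst_blinfun o\<^sub>L g' u))"

lemma action_form_apply: "action_form g g' u h = - 2 * (snd (g u) \<bullet> fst (g' u h))"
  by (simp add: action_form_def uminus_blinfun.rep_eq scaleR_blinfun.rep_eq blinfun_inner_right.rep_eq)

lemma C1_on_action_form:
  assumes "C1_on U g" "C1_on U g'"
  shows "C1_on U (action_form g g')"
proof -
  have "C1_on U (\<lambda>u. blinfun_inner_right (snd (g u)))"
    by (rule C1_on_linear_compose[OF bounded_linear_compose[OF bounded_linear_blinfun_inner_right bounded_linear_snd] assms(1)])
  moreover have "C1_on U (\<lambda>u. fst_blinfun o\<^sub>L g' u)"
    by (rule C1_on_linear_compose[OF bounded_bilinear.bounded_linear_right[OF bounded_bilinear_blinfun_compose] assms(2)])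
  ultimately show ?thesis
    unfolding action_form_def[abs_def]
    by (rule C1_on_linear_compose[OF bounded_linear_scaleR_right
          C1_on_bilinear[OF bounded_bilinear_blinfun_compose]])
qed

text \<open>The terms with the second derivative of \<open>g\<close> cancel by symmetry.\<close>

lemma action_form_exterior_derivative:
  assumes U: "open U" "u \<in> U"
    and g': "\<And>x. x \<in> U \<Longrightarrow> (g has_derivative blinfun_apply (g' x)) (at x)"
    and g'': "(g' has_derivative g'') (at u)"
    and A': "(action_form g g' has_derivative A') (at u)"
  shows "blinfun_apply (A' h) k - blinfun_apply (A' k) h = - 2 * canonical_symplectic (g' u h) (g' u k)"
proof -
  have 1: "((\<lambda>u. blinfun_inner_right (snd (g u))) has_derivative (\<lambda>h. blinfun_inner_right (snd (g' u h)))) (at u)"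
    by (rule bounded_linear.has_derivative[OF bounded_linear_blinfun_inner_right has_derivative_snd[OF g'[OF U(2)]]])
  have 2: "((\<lambda>u. fst_blinfun o\<^sub>L g' u) has_derivative (\<lambda>h. fst_blinfun o\<^sub>L g'' h)) (at u)"
    by (rule bounded_linear.has_derivative[OF
            bounded_bilinear.bounded_linear_right[OF bounded_bilinear_blinfun_compose] g''])
  have "(action_form g g' has_derivative (\<lambda>h. (-2) *\<^sub>R (
      (blinfun_inner_right (snd (g u)) o\<^sub>L (fst_blinfun o\<^sub>L g'' h)) +
      (blinfun_inner_right (snd (g' u h)) o\<^sub>L (fst_blinfun o\<^sub>L g' u))))) (at u)"
    unfolding action_form_def[abs_def]
    by (rule has_derivative_scaleR_right[OF bounded_bilinear.FDERIV[OF bounded_bilinear_blinfun_compose 1 2]])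
  from has_derivative_unique[OF A' this]
  have "A' h k = - 2 * (snd (g u) \<bullet> fst (g'' h k) + snd (g' u h) \<bullet> fst (g' u k))" for h k
    by (simp add: uminus_blinfun.rep_eq scaleR_blinfun.rep_eq plus_blinfun.rep_eq blinfun_inner_right.rep_eq)
  moreover have "g'' h k = g'' k h"
    by (rule symmetric_second_derivative[OF U g' g''])
  ultimately show ?thesis by (simp add: canonical_symplectic_def)
qed

text \<open>By the focal point equation, \<open>h\<close> is focal at \<open>r\<close> when the \<open>b\<close>-component of \<open>D h\<close> is \<open>T - exp (- 2 r)\<close>
  applied to its \<open>a\<close>-component, with a symmetric operator \<open>T\<close> independent of \<open>r\<close>. On
  an isotropic subspace the contributions of \<open>T\<close> cancel, so vectors that are focal at different
  parameters have orthogonal nonzero \<open>a\<close>-components. Three of these do not fit into the plane.\<close>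

lemma exists_nonfocal_parameter:
  fixes D :: "'a::real_vector \<Rightarrow> complex \<times> complex"
  assumes D: "linear D" "inj D" and lag: "\<And>h k. canonical_symplectic (D h) (D k) = 0"
  shows "\<exists>r. \<forall>h. snd (D h) = (2 * (b \<bullet> fst (D h))) *\<^sub>R b
      - (exp (- r) * exp (- r) + (norm b)\<^sup>2) *\<^sub>R fst (D h) \<longrightarrow> h = 0"
proof (rule ccontr)
  assume "\<not> ?thesis"
  then obtain H where H: "\<And>r. H r \<noteq> 0" "\<And>r. snd (D (H r)) = (2 * (b \<bullet> fst (D (H r)))) *\<^sub>R b
      - (exp (- r) * exp (- r) + (norm b)\<^sup>2) *\<^sub>R fst (D (H r))"
    by metis
  define a where "a r = fst (D (H r))" for r
  have a0: "a r \<noteq> 0" for r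
  proof
    assume "a r = 0"
    then have "D (H r) = 0" using H(2)[of r] by (simp add: a_def prod_eq_iff)
    then show False using H(1)[of r] D linear_injective_0 by blast
  qed
  have orth: "a r \<bullet> a s = 0" if "r \<noteq> s" for r s
  proof -
    have "canonical_symplectic (D (H r)) (D (H s)) = (exp (- s) * exp (- s) - exp (- r) * exp (- r)) * (a r \<bullet> a s)"
      unfolding canonical_symplectic_def H(2) a_def[symmetric]
      by (simp add: inner_diff_left algebra_simps inner_commute[of "a s"])
    then have "(exp (- s) * exp (- s) - exp (- r) * exp (- r)) * (a r \<bullet> a s) = 0" using lag by simp
    moreover have "exp (- s) * exp (- s) \<noteq> exp (- r) * exp (- r)"
      using that by (simp add: exp_add[symmetric])
    ultimately show ?thesis by simp
  qed
  have ne: "a r \<noteq> a s" if "r \<noteq> s" for r s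
    using orth[OF that] a0[of r] by auto
  let ?S = "{a 0, a 1, a 2}"
  have "pairwise orthogonal ?S"
    by (auto simp: pairwise_def orthogonal_def orth)
  then have "independent ?S"
    by (rule pairwise_orthogonal_independent) (use a0 in auto)
  then have "card ?S \<le> DIM(complex)" using independent_bound by blast
  moreover have "card ?S = 3" using ne[of 0 1] ne[of 0 2] ne[of 1 2] by simp
  ultimately show False by simp
qed

section \<open>Orthogonal surfaces and isotropy in canonical coordinates\<close>

theorem lagrangian_imp_orthogonal_surface:
  fixes g :: "real^2 \<Rightarrow> complex \<times> complex"
  assumes U: "open U" "u0 \<in> U" and C2: "C2_on U g"
    and imm: "inj (frechet_derivative g (at u0))"
    and lag: "\<And>u h k. u \<in> U \<Longrightarrow>
      canonical_symplectic (frechet_derivative g (at u) h) (frechet_derivative g (at u) k) = 0"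
  shows "\<exists>\<epsilon>>0. \<exists>S. ball u0 \<epsilon> \<subseteq> U \<and> embedded_surface S \<and>
    (\<forall>u\<in>ball u0 \<epsilon>. meets_orthogonally (horo_geodesic (g u)) S)"
proof -
  obtain g' where g': "\<And>u. u \<in> U \<Longrightarrow> (g has_derivative blinfun_apply (g' u)) (at u)" and C1': "C1_on U g'"
    using C2 unfolding C2_on_iff_C1_derivative by blast
  have fr: "frechet_derivative g (at u) = blinfun_apply (g' u)" if "u \<in> U" for u
    using frechet_derivative_at[OF g'[OF that]] by simp
  obtain g'' where g'': "\<And>u. u \<in> U \<Longrightarrow> (g' has_derivative blinfun_apply (g'' u)) (at u)"
    using C1' unfolding C1_on_def by blast
  obtain d where d: "d > 0" "ball u0 d \<subseteq> U" using U open_contains_ball by blast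
  have u0: "u0 \<in> ball u0 d" using d by simp
  define A where "A = action_form g g'"
  have C1A: "C1_on U A" unfolding A_def by (rule C1_on_action_form[OF C2_on_imp_C1_on[OF C2] C1'])
  obtain A' where A': "\<And>u. u \<in> U \<Longrightarrow> (A has_derivative blinfun_apply (A' u)) (at u)" "continuous_on U A'"
    using C1A unfolding C1_on_def by blast
  have sym: "A' u h k = A' u k h" if "u \<in> ball u0 d" for u h k
  proof -
    have uU: "u \<in> U" using that d(2) by blast
    show ?thesis
      using action_form_exterior_derivative[OF U(1) uU g' g''[OF uU] A'(1)[OF uU, unfolded A_def], of h k]
        lag[OF uU, of h k] unfolding fr[OF uU] by simp
  qed
  obtain r0 where r0: "\<And>h. snd (g' u0 h) = (2 * (snd (g u0) \<bullet> fst (g' u0 h))) *\<^sub>R snd (g u0)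
      - (exp (- r0) * exp (- r0) + (norm (snd (g u0)))\<^sup>2) *\<^sub>R fst (g' u0 h) \<Longrightarrow> h = 0"
    using exists_nonfocal_parameter[of "blinfun_apply (g' u0)" "snd (g u0)"] imm lag[OF U(2)]
      fr[OF U(2)] linear_conv_bounded_linear blinfun.bounded_linear_right by metis
  have "\<exists>\<rho>. \<rho> u0 = r0 \<and> (\<forall>u\<in>ball u0 d. (\<rho> has_derivative blinfun_apply (A u)) (at u))"
    by (rule closed_one_form_has_primitive[OF _ continuous_on_subset[OF A'(2) d(2)] sym])
      (use A'(1) d(2) in auto)
  then obtain \<rho> where \<rho>: "\<rho> u0 = r0" "\<And>u. u \<in> ball u0 d \<Longrightarrow> (\<rho> has_derivative blinfun_apply (A u)) (at u)"
    by blast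
  have C2\<rho>: "C2_on (ball u0 d) \<rho>"
    unfolding C2_on_iff_C1_derivative using \<rho>(2) C1_on_subset[OF C1A d(2)] by blast
  \<comment> \<open>The point at a given parameter of a given geodesic; \<open>r0\<close> was chosen so that this map is
    immersive at \<open>(u0, r0)\<close>.\<close>
  define F where "F q = horo_geodesic (g (fst q)) (snd q)" for q
  have C2F: "C2_on (ball u0 d \<times> UNIV) F"
  proof -
    have "C2_on (ball u0 d \<times> UNIV) (\<lambda>q. g (fst q))"
      by (rule C2_on_compose[OF C2_on_subset[OF C2 d(2)] C2_on_fst[OF C2_on_ident]]) auto
    then have "C2_on (ball u0 d \<times> (UNIV :: real set)) (\<lambda>q. (g (fst q), snd q))"
      by (intro C2_on_intros)
    from C2_on_compose[OF C2_on_horo_geodesic this, of UNIV] show ?thesis unfolding F_def by simp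
  qed
  have opn: "open (ball u0 d \<times> (UNIV :: real set))" by (intro open_Times open_ball open_UNIV)
  obtain F0 where F0: "(F has_derivative F0) (at (u0, r0))" "inj F0"
  proof -
    obtain E where E: "((\<lambda>q. horo_geodesic (fst q) (snd q)) has_derivative E) (at (g u0, r0))"
      using C2_on_horo_geodesic[of UNIV] unfolding C2_on_def by blast
    have *: "((\<lambda>q. (g (fst q), snd q)) has_derivative (\<lambda>\<delta>. (g' u0 (fst \<delta>), snd \<delta>))) (at (u0, r0))"
      using has_derivative_compose[OF has_derivative_fst[OF has_derivative_ident], of g "g' u0" "(u0, r0)"]
        g'[OF U(2)] by (intro has_derivative_Pair has_derivative_snd has_derivative_ident) auto
    have FD: "(F has_derivative (\<lambda>\<delta>. E (g' u0 (fst \<delta>), snd \<delta>))) (at (u0, r0))"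
      using has_derivative_compose[OF *, of "\<lambda>q. horo_geodesic (fst q) (snd q)" E] E by (simp add: F_def[abs_def])
    have "\<delta> = 0" if "E (g' u0 (fst \<delta>), snd \<delta>) = 0" for \<delta>
    proof -
      note k = horo_geodesic_derivative_kernel[OF E that]
      have "fst \<delta> = 0" by (rule r0) (use k(1) in simp)
      with k(2) show ?thesis by (simp add: prod_eq_iff)
    qed
    then have "inj (\<lambda>\<delta>. E (g' u0 (fst \<delta>), snd \<delta>))"
      using has_derivative_linear[OF FD] linear_injective_0 by blast
    with FD that show ?thesis by blast
  qed
  obtain R where R: "R > 0" "ball (u0, r0) R \<subseteq> ball u0 d \<times> UNIV" "inj_on F (ball (u0, r0) R)"
      "\<And>q D. q \<in> ball (u0, r0) R \<Longrightarrow> (F has_derivative D) (at q) \<Longrightarrow> inj D"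
    using C1_immersion_locally_injective[OF C2_on_imp_C1_on[OF C2F] opn _ F0] d(1) by auto
  have inR: "(u, r) \<in> ball (u0, r0) R" if "dist u u0 < R / 2" "dist r r0 < R / 2" for u r
  proof -
    have "dist (u0, r0) (u, r) \<le> dist u0 u + dist r0 r"
      unfolding dist_Pair_Pair by (rule sqrt_sum_squares_le_sum) auto
    then show ?thesis using that by (simp add: dist_commute)
  qed
  define X where "X u = horo_geodesic (g u) (\<rho> u)" for u
  have XF: "X u = F (u, \<rho> u)" for u by (simp add: X_def F_def)
  have C2X: "C2_on (ball u0 d) X"
    unfolding XF[abs_def] by (rule C2_on_compose[OF C2F C2_on_Pair[OF C2_on_ident C2\<rho>]]) auto
  have contX: "continuous_on (ball u0 d) X"
    by (rule C1_on_imp_continuous_on[OF C2_on_imp_C1_on[OF C2X]])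
  \<comment> \<open>It remains to shrink the surface so that every intersection of a nearby geodesic with it
    has a parameter close to \<open>r0\<close>. That parameter is a Busemann function of the intersection point, which is continuous.\<close>
  obtain e1 where e1: "e1 > 0" "\<And>u. dist u u0 < e1 \<Longrightarrow> dist (\<rho> u) r0 < R / 2"
    using has_derivative_continuous[OF \<rho>(2)[OF u0]] R(1) \<rho>(1)
    unfolding continuous_at_eps_delta by (metis half_gt_zero dist_norm)
  have "isCont (\<lambda>q. busemann (fst (g (fst q))) (X (snd q))) (u0, u0)"
  proof -
    have "isCont X u0" using contX u0 by (simp add: continuous_on_eq_continuous_at)
    moreover have "isCont g u0" using has_derivative_continuous[OF g'[OF U(2)]] .
    ultimately have "isCont (\<lambda>q. (fst (g (fst q)), X (snd q))) (u0, u0)"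
      by (intro continuous_intros isCont_o2[of _ fst g] isCont_o2[of _ snd X]) auto
    moreover have "isCont (\<lambda>y. busemann (fst y) (snd y)) (fst (g u0), X u0)"
      unfolding X_def by (rule has_derivative_continuous[OF busemann_has_derivative])
    ultimately show ?thesis
      using isCont_o2[of "(u0, u0)" "\<lambda>q. (fst (g (fst q)), X (snd q))" "\<lambda>y. busemann (fst y) (snd y)"] by simp
  qed
  then obtain e3 where e3: "e3 > 0" "\<And>q. dist q (u0, u0) < e3 \<Longrightarrow>
      dist (busemann (fst (g (fst q))) (X (snd q))) r0 < R / 2"
    unfolding continuous_at_eps_delta using R(1)
    by (metis half_gt_zero fst_conv snd_conv X_def busemann_horo_geodesic \<rho>(1))
  define e2 where "e2 = min d (min e1 (R / 2))"
  define \<epsilon> where "\<epsilon> = min e2 e3 / 2"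
  have \<epsilon>: "0 < \<epsilon>" "\<epsilon> < e2" "e2 \<le> d" "2 * \<epsilon> \<le> e3"
    unfolding \<epsilon>_def e2_def using d(1) e1(1) e3(1) R(1) by auto
  have in_d: "u \<in> ball u0 d" and in_R: "(u, \<rho> u) \<in> ball (u0, r0) R" if "u \<in> ball u0 e2" for u
    using that inR[of u "\<rho> u"] e1(2)[of u] unfolding e2_def by (auto simp: dist_commute)
  have injX: "inj_on X (ball u0 e2)"
  proof (rule inj_onI)
    fix u v assume uv: "u \<in> ball u0 e2" "v \<in> ball u0 e2" "X u = X v"
    then have "(u, \<rho> u) = (v, \<rho> v)"
      using inj_onD[OF R(3)] in_R unfolding XF by blast
    then show "u = v" by simp
  qed
  obtain Y where Y: "homeomorphism (ball u0 \<epsilon>) (X ` ball u0 \<epsilon>) X Y"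
    using homeomorphism_onto_image_ball[OF continuous_on_subset[OF contX subset_ball[OF \<epsilon>(3)]] injX \<epsilon>(2)]
    by blast
  have X': "\<exists>X'. (X has_derivative X') (at u) \<and> inj X'" if u: "u \<in> ball u0 e2" for u
  proof -
    obtain F' where F': "(F has_derivative F') (at (u, \<rho> u))"
      using C2F in_d[OF u] unfolding C2_on_def by blast
    have "inj F'" by (rule R(4)[OF in_R[OF u] F'])
    have "((\<lambda>u. (u, \<rho> u)) has_derivative (\<lambda>h. (h, A u h))) (at u)"
      by (intro has_derivative_Pair has_derivative_ident \<rho>(2) in_d u)
    from has_derivative_compose[OF this F'] have "(X has_derivative (\<lambda>h. F' (h, A u h))) (at u)"
      by (simp add: XF[abs_def])
    moreover have "inj (\<lambda>h. F' (h, A u h))"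
      using \<open>inj F'\<close> by (auto simp: inj_def)
    ultimately show ?thesis by blast
  qed
  have sub: "ball u0 \<epsilon> \<subseteq> ball u0 e2" using \<epsilon>(2) by auto
  have emb: "embedded_surface (X ` ball u0 \<epsilon>)"
    unfolding embedded_surface_def
  proof (intro conjI ballI)
    show "X ` ball u0 \<epsilon> \<subseteq> H3" unfolding X_def by (intro image_subsetI horo_geodesic_in_H3)
    have "C2_immersion_on (ball u0 \<epsilon>) X"
      unfolding C2_immersion_on_def
    proof (intro conjI ballI)
      show "C2_on (ball u0 \<epsilon>) X" by (rule C2_on_subset[OF C2X]) (use \<epsilon> in auto)
      show "inj (frechet_derivative X (at u))" if "u \<in> ball u0 \<epsilon>" for u
        using X'[of u] that sub frechet_derivative_at by (metis subsetD)
    qed auto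
    then have *: "open UNIV \<and> x \<in> UNIV \<and> C2_immersion_on (ball u0 \<epsilon>) X \<and>
        homeomorphism (ball u0 \<epsilon>) (X ` ball u0 \<epsilon> \<inter> UNIV) X Y" for x :: "real \<times> complex"
      using Y by simp
    show "\<exists>V U (\<phi> :: real^2 \<Rightarrow> real \<times> complex) \<psi>. open V \<and> x \<in> V \<and> C2_immersion_on U \<phi> \<and>
        homeomorphism U (X ` ball u0 \<epsilon> \<inter> V) \<phi> \<psi>" for x
      by (rule exI[of _ UNIV], rule exI[of _ "ball u0 \<epsilon>"], rule exI[of _ X], rule exI[of _ Y], rule *)
  qed
  have meets: "meets_orthogonally (horo_geodesic (g u)) (X ` ball u0 \<epsilon>)" if u: "u \<in> ball u0 \<epsilon>" for u
    unfolding meets_orthogonally_def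
  proof (intro conjI allI impI ballI)
    show "range (horo_geodesic (g u)) \<inter> X ` ball u0 \<epsilon> \<noteq> {}" using u unfolding X_def by blast
    fix r v assume hit: "horo_geodesic (g u) r \<in> X ` ball u0 \<epsilon>"
      and v: "v \<in> tangent_space (X ` ball u0 \<epsilon>) (horo_geodesic (g u) r)"
    obtain w where w: "w \<in> ball u0 \<epsilon>" "horo_geodesic (g u) r = X w" using hit by blast
    have "dist (u, w) (u0, u0) \<le> dist u u0 + dist w u0"
      unfolding dist_Pair_Pair by (rule sqrt_sum_squares_le_sum) auto
    then have "dist (u, w) (u0, u0) < e3" using u w(1) \<epsilon>(4) by (simp add: dist_commute)
    from e3(2)[OF this] have "dist r r0 < R / 2"
      unfolding fst_conv snd_conv w(2)[symmetric] busemann_horo_geodesic .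
    then have "(u, r) \<in> ball (u0, r0) R"
      using inR[of u r] u \<epsilon>(2) unfolding e2_def by (auto simp: dist_commute)
    \<comment> \<open>Both sides are in the region where \<open>F\<close> is injective, so the geodesic meets the surface
      only at its own point.\<close>
    then have "(u, r) = (w, \<rho> w)"
      using inj_onD[OF R(3), of "(u, r)" "(w, \<rho> w)"] in_R[of w] w sub unfolding XF by (auto simp: F_def)
    then have r: "r = \<rho> u" by simp
    obtain X' where X': "(X has_derivative X') (at u)" "inj X'" using X'[of u] u sub by blast
    have vel: "vector_derivative (horo_geodesic (g u)) (at r) = velocity (g u) r"
      by (rule vector_derivative_at[OF horo_geodesic_has_velocity])
    have "hyp_metric (horo_geodesic (g u) r) (X' h) (velocity (g u) r) = 0" for h
    proof -
      have u2: "u \<in> ball u0 e2" using u sub by blast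
      then have uU: "u \<in> U" using in_d d(2) by blast
      show ?thesis
        using first_variation[OF g'[OF uU] X'(1)[unfolded X_def[abs_def]] \<rho>(2)[OF in_d[OF u2]], of h]
        unfolding r A_def action_form_apply by simp
    qed
    from tangent_space_image_immersion[OF Y u X' _ bounded_linear_hyp_metric this]
    show "hyp_metric (horo_geodesic (g u) r) v (vector_derivative (horo_geodesic (g u)) (at r)) = 0"
      unfolding vel using v by (simp add: r X_def)
  qed
  show ?thesis
    using \<epsilon> emb meets d(2) by (intro exI[of _ \<epsilon>] conjI exI[of _ "X ` ball u0 \<epsilon>"]) auto
qed

lemma linear_injective_imp_surj:
  fixes L :: "'a::euclidean_space \<Rightarrow> 'b::euclidean_space"
  assumes "linear L" "inj L" "DIM('a) = DIM('b)"
  shows "surj L"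
proof -
  have "dim (range L) = DIM('b)"
    using dim_image_eq[OF assms(1), of UNIV] assms(2,3) by (simp add: span_UNIV)
  then have "span (range L) = UNIV" by (simp add: dim_eq_full)
  then show ?thesis
    using linear_subspace_image[OF assms(1) subspace_UNIV] by (simp add: span_eq_iff[THEN iffD2])
qed

theorem orthogonal_surface_imp_lagrangian:
  fixes g :: "real^2 \<Rightarrow> complex \<times> complex"
  assumes U: "open U" "u0 \<in> U" and C2: "C2_on U g" and S: "embedded_surface S"
    and meets: "\<And>u. u \<in> U \<Longrightarrow> meets_orthogonally (horo_geodesic (g u)) S"
  shows "canonical_symplectic (frechet_derivative g (at u0) h) (frechet_derivative g (at u0) k) = 0"
proof -
  obtain g' where g': "\<And>u. u \<in> U \<Longrightarrow> (g has_derivative blinfun_apply (g' u)) (at u)" and C1': "C1_on U g'"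
    using C2 unfolding C2_on_iff_C1_derivative by blast
  obtain r0 where r0: "horo_geodesic (g u0) r0 \<in> S"
    using meets[OF U(2)] unfolding meets_orthogonally_def by blast
  obtain V W and \<phi> :: "real^2 \<Rightarrow> real \<times> complex" and \<psi> where
    V: "open V" "horo_geodesic (g u0) r0 \<in> V" and \<phi>: "C2_immersion_on W \<phi>" and hom: "homeomorphism W (S \<inter> V) \<phi> \<psi>"
    using S r0 unfolding embedded_surface_def by blast
  have W: "open W" and C2\<phi>: "C2_on W \<phi>" and inj\<phi>: "\<And>s. s \<in> W \<Longrightarrow> inj (frechet_derivative \<phi> (at s))"
    using \<phi> unfolding C2_immersion_on_def by auto
  define s0 where "s0 = \<psi> (horo_geodesic (g u0) r0)"
  have s0: "s0 \<in> W" "\<phi> s0 = horo_geodesic (g u0) r0"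
    using hom r0 V unfolding s0_def homeomorphism_def by blast+
  obtain \<phi>' where \<phi>': "\<And>s. s \<in> W \<Longrightarrow> (\<phi> has_derivative blinfun_apply (\<phi>' s)) (at s)"
    using C2\<phi> unfolding C2_on_def by blast
  have orth: "hyp_metric (horo_geodesic (g u) r) (\<phi>' s h) (velocity (g u) r) = 0"
    if "s \<in> W" "u \<in> U" "\<phi> s = horo_geodesic (g u) r" for s u r h
  proof -
      obtain \<epsilon> where \<epsilon>: "\<epsilon> > 0" "\<And>\<tau>. dist \<tau> (0::real) < \<epsilon> \<Longrightarrow> s + \<tau> *\<^sub>R h \<in> W"
      proof -
        have "open ((\<lambda>\<tau>::real. s + \<tau> *\<^sub>R h) -` W)"
          by (intro open_vimage W continuous_intros)
        moreover have "0 \<in> (\<lambda>\<tau>::real. s + \<tau> *\<^sub>R h) -` W" using \<open>s \<in> W\<close> by simp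
        ultimately obtain \<epsilon> where "\<epsilon> > 0" "ball 0 \<epsilon> \<subseteq> (\<lambda>\<tau>::real. s + \<tau> *\<^sub>R h) -` W"
          using open_contains_ball by blast
        then show ?thesis using that by (auto simp: dist_commute subset_iff)
      qed
    have "\<phi>' s h \<in> tangent_space S (\<phi> s)"
      unfolding tangent_space_def
    proof (intro CollectI exI[of _ "\<lambda>\<tau>. \<phi> (s + \<tau> *\<^sub>R h)"] exI[of _ \<epsilon>] conjI allI impI)
      show "\<epsilon> > 0" by fact
      show "\<phi> (s + \<tau> *\<^sub>R h) \<in> S" if "\<bar>\<tau>\<bar> < \<epsilon>" for \<tau>
        using \<epsilon>(2)[of \<tau>] that hom unfolding homeomorphism_def by auto
      show "\<phi> (s + 0 *\<^sub>R h) = \<phi> s" by simp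
      have "((\<lambda>\<tau>. \<phi> (s + \<tau> *\<^sub>R h)) has_derivative (\<lambda>\<tau>. \<phi>' s (\<tau> *\<^sub>R h))) (at 0)"
        by (rule has_derivative_compose[where f = "\<lambda>\<tau>. s + \<tau> *\<^sub>R h" and g = \<phi>])
          (use \<phi>'[OF that(1)] in \<open>auto intro!: derivative_eq_intros\<close>)
      then show "((\<lambda>\<tau>. \<phi> (s + \<tau> *\<^sub>R h)) has_vector_derivative \<phi>' s h) (at 0)"
        by (simp add: has_vector_derivative_def blinfun.scaleR_right)
    qed
    moreover have "horo_geodesic (g u) r \<in> S"
      using that(1,3) hom unfolding homeomorphism_def by (metis IntD1 imageI)
    ultimately show ?thesis
      using meets[OF that(2)] that(3) vector_derivative_at[OF horo_geodesic_has_velocity]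
      unfolding meets_orthogonally_def by metis
  qed
  \<comment> \<open>Orthogonality at the base point makes the surface and the geodesic transversal: \<open>L\<close> is
    an isomorphism.\<close>
  obtain E where E: "((\<lambda>q. horo_geodesic (fst q) (snd q)) has_derivative E) (at (g u0, r0))"
    using C2_on_horo_geodesic[of UNIV] unfolding C2_on_def by blast
  have linE: "linear E" using E has_derivative_linear by blast
  have E_hyp: "hyp_metric (horo_geodesic (g u0) r0) (E (0, \<tau>)) (velocity (g u0) r0) = \<tau>" for \<tau>
    using first_variation[where g = fst and \<rho> = snd and u = "(g u0, r0)" and h = "(0, \<tau>)", OF _ E,
        OF has_derivative_fst[OF has_derivative_ident] has_derivative_snd[OF has_derivative_ident]]
    by simp
  define L where "L y = \<phi>' s0 (fst y) - E (0, snd y)" for y :: "(real^2) \<times> real"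
  have linL: "linear L"
    unfolding L_def by (intro linear_compose_sub bounded_linear.linear[OF bounded_linear_compose[OF
      blinfun.bounded_linear_right bounded_linear_fst]]
      linear_compose[OF _ linE, of "\<lambda>y. (0, snd y)", unfolded o_def] bounded_linear.linear[OF
      bounded_linear_Pair[OF bounded_linear_zero bounded_linear_snd]])
  have injL: "inj L"
  proof -
    have "y = 0" if "L y = 0" for y
    proof -
      have eq: "\<phi>' s0 (fst y) = E (0, snd y)" using that by (simp add: L_def)
      have "snd y = 0" using E_hyp[of "snd y"] orth[OF s0(1) U(2) s0(2), of "fst y"] eq by simp
      moreover have "\<phi>' s0 (fst y) = 0"
        using eq \<open>snd y = 0\<close> linear_0[OF linE] by (simp add: zero_prod_def)
      then have "fst y = 0"
        using inj\<phi>[OF s0(1)] frechet_derivative_at[OF \<phi>'[OF s0(1)]]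
        by (metis blinfun.zero_right injD)
      ultimately show ?thesis by (simp add: prod_eq_iff)
    qed
    then show ?thesis using linear_injective_0[OF linL] by blast
  qed
  have surjL: "surj L" by (rule linear_injective_imp_surj[OF linL injL]) simp
  obtain M where M: "linear M" "M \<circ> L = id"
    using linear_injective_left_inverse[OF linL injL] by blast
  have blM: "bounded_linear M" using M(1) linear_conv_bounded_linear by blast
  have M0: "x = 0" if "M x = 0" for x
  proof -
    obtain y where "x = L y" using surjL by blast
    with that M(2) show ?thesis by (metis comp_apply id_apply linear_0[OF linL])
  qed
  \<comment> \<open>The zeros of the second component are the intersections. The map \<open>M\<close>, the inverse of \<open>L\<close>, only serves to give
    \<open>\<Theta>\<close> equal source and target types, as the inverse function theorem requires.\<close>
  define \<Theta> where "\<Theta> q = (fst q, M (\<phi> (fst (snd q)) - horo_geodesic (g (fst q)) (snd (snd q))))"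
    for q :: "(real^2) \<times> (real^2) \<times> real"
  let ?D = "U \<times> W \<times> (UNIV::real set)"
  have openD: "open ?D" by (intro open_Times U W open_UNIV)
  have C2\<Theta>: "C2_on ?D \<Theta>"
  proof -
    have 1: "C2_on ?D (\<lambda>q. \<phi> (fst (snd q)))"
      by (rule C2_on_compose[OF C2\<phi>]) (auto intro!: C2_on_intros)
    have "C2_on ?D (\<lambda>q. g (fst q))"
      by (rule C2_on_compose[OF C2]) (auto intro!: C2_on_intros)
    then have 2: "C2_on ?D (\<lambda>q. (g (fst q), snd (snd q)))"
      by (intro C2_on_intros)
    have 3: "C2_on ?D (\<lambda>q. horo_geodesic (g (fst q)) (snd (snd q)))"
      using C2_on_compose[OF C2_on_horo_geodesic 2, of UNIV] by simp
    have 4: "C2_on ?D (\<lambda>q. M (\<phi> (fst (snd q)) - horo_geodesic (g (fst q)) (snd (snd q))))"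
      using C2_on_linear_compose[OF blM C2_on_add[OF 1 C2_on_minus[OF 3]]] by simp
    show ?thesis
      unfolding \<Theta>_def[abs_def] by (rule C2_on_Pair[OF C2_on_fst[OF C2_on_ident] 4])
  qed
  obtain \<Theta>' where \<Theta>': "\<And>q. q \<in> ?D \<Longrightarrow> (\<Theta> has_derivative blinfun_apply (\<Theta>' q)) (at q)" "continuous_on ?D \<Theta>'"
    using C2_on_imp_C1_on[OF C2\<Theta>] unfolding C1_on_def by blast
  let ?q0 = "(u0, s0, r0)"
  have q0: "?q0 \<in> ?D" using U s0 by simp
  have \<Theta>'0: "\<Theta>' ?q0 \<delta> = (fst \<delta>, M (\<phi>' s0 (fst (snd \<delta>)) - E (g' u0 (fst \<delta>), snd (snd \<delta>))))" for \<delta>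
  proof -
    have i1: "(fst has_derivative fst) (at ?q0)" "((\<lambda>q. fst (snd q)) has_derivative (\<lambda>q. fst (snd q))) (at ?q0)"
      "((\<lambda>q. snd (snd q)) has_derivative (\<lambda>q. snd (snd q))) (at ?q0)"
      by (auto intro!: derivative_intros)
    have 1: "((\<lambda>q. \<phi> (fst (snd q))) has_derivative (\<lambda>\<delta>. \<phi>' s0 (fst (snd \<delta>)))) (at ?q0)"
      using has_derivative_compose[OF i1(2), of \<phi> "\<phi>' s0"] \<phi>'[OF s0(1)] by simp
    have 2: "((\<lambda>q. g (fst q)) has_derivative (\<lambda>\<delta>. g' u0 (fst \<delta>))) (at ?q0)"
      using has_derivative_compose[OF i1(1), of g "g' u0"] g'[OF U(2)] by simp
    have 3: "((\<lambda>q. horo_geodesic (g (fst q)) (snd (snd q))) has_derivative (\<lambda>\<delta>. E (g' u0 (fst \<delta>), snd (snd \<delta>)))) (at ?q0)"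
      using has_derivative_compose[OF has_derivative_Pair[OF 2 i1(3)], of "\<lambda>q. horo_geodesic (fst q) (snd q)" E] E
      by simp
    have "(\<Theta> has_derivative (\<lambda>\<delta>. (fst \<delta>, M (\<phi>' s0 (fst (snd \<delta>)) - E (g' u0 (fst \<delta>), snd (snd \<delta>)))))) (at ?q0)"
      unfolding \<Theta>_def[abs_def]
      by (rule has_derivative_Pair[OF i1(1) bounded_linear.has_derivative[OF blM has_derivative_diff[OF 1 3]]])
    from fun_cong[OF has_derivative_unique[OF this \<Theta>'(1)[OF q0]], of \<delta>] show ?thesis by simp
  qed
  have inj\<Theta>: "inj (blinfun_apply (\<Theta>' ?q0))"
  proof -
    have "\<delta> = 0" if "\<Theta>' ?q0 \<delta> = 0" for \<delta>
    proof -
      have f: "fst \<delta> = 0" using that unfolding \<Theta>'0 by (simp add: prod_eq_iff)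
      have "M (L (snd \<delta>)) = 0" using that f unfolding \<Theta>'0 L_def by (simp add: prod_eq_iff zero_prod_def)
      then have "snd \<delta> = 0" using M(2) by (metis comp_apply id_apply)
      with f show ?thesis by (simp add: prod_eq_iff)
    qed
    then show ?thesis
      using linear_injective_0[OF bounded_linear.linear[OF blinfun.bounded_linear_right]] by blast
  qed
  obtain I where I: "linear I" "I \<circ> blinfun_apply (\<Theta>' ?q0) = id"
    using linear_injective_left_inverse[OF bounded_linear.linear[OF blinfun.bounded_linear_right] inj\<Theta>] by blast
  have IF: "Blinfun I o\<^sub>L \<Theta>' ?q0 = id_blinfun"
    using I by (intro blinfun_eqI)
      (simp add: bounded_linear_Blinfun_apply linear_conv_bounded_linear pointfree_idE)
  obtain D' R G G' where D': "D' \<subseteq> ?D" and R: "open R" "\<Theta> ?q0 \<in> R"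
    and homG: "homeomorphism D' R \<Theta> G" and G': "\<And>y. y \<in> R \<Longrightarrow> (G has_derivative G' y) (at y)"
  proof (rule inverse_function_theorem[OF openD \<Theta>' q0 IF])
    fix D' R G G'
    assume *: "D' \<subseteq> ?D" "open R" "\<Theta> ?q0 \<in> R" "homeomorphism D' R \<Theta> G"
      "\<And>y. y \<in> R \<Longrightarrow> (G has_derivative G' y) (at y)"
    show thesis by (rule that[of D' R G G', OF *])
  qed
  have \<Theta>q0: "\<Theta> ?q0 = (u0, 0)" by (simp add: \<Theta>_def s0 linear_0[OF M(1)])
  define N where "N = (\<lambda>u. (u, 0::(real^2) \<times> real)) -` R"
  have N: "open N" "u0 \<in> N"
    unfolding N_def using R \<Theta>q0 by (auto intro!: open_vimage continuous_intros)
  \<comment> \<open>The geodesic of \<open>u\<close> meets the surface at the point \<open>\<phi> (s u)\<close> and the parameter \<open>\<rho> u\<close>.\<close>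
  define s where "s u = fst (snd (G (u, 0)))" for u
  define \<rho> where "\<rho> u = snd (snd (G (u, 0)))" for u
  have sol: "u \<in> U" "s u \<in> W" "\<phi> (s u) = horo_geodesic (g u) (\<rho> u)" if "u \<in> N" for u
  proof -
    have uR: "(u, 0) \<in> R" using that by (simp add: N_def)
    have \<Theta>G: "\<Theta> (G (u, 0)) = (u, 0)" by (rule homeomorphism_apply2[OF homG uR])
    have "G (u, 0) \<in> ?D" using homG uR D' unfolding homeomorphism_def by blast
    then show "u \<in> U" "s u \<in> W" using \<Theta>G by (auto simp: \<Theta>_def s_def)
    have "\<phi> (s u) - horo_geodesic (g u) (\<rho> u) = 0"
      by (rule M0) (use \<Theta>G in \<open>auto simp: \<Theta>_def s_def \<rho>_def\<close>)
    then show "\<phi> (s u) = horo_geodesic (g u) (\<rho> u)" by simp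
  qed
  have der_\<rho>: "(\<rho> has_derivative blinfun_apply (action_form g g' u)) (at u)" if u: "u \<in> N" for u
  proof -
    have uR: "(u, 0) \<in> R" using u by (simp add: N_def)
    have "((\<lambda>u. (u, 0::(real^2) \<times> real)) has_derivative (\<lambda>h. (h, 0))) (at u)"
      by (intro has_derivative_Pair has_derivative_ident has_derivative_const)
    from has_derivative_compose[OF this G'[OF uR]]
    have G: "((\<lambda>u. G (u, 0)) has_derivative (\<lambda>h. G' (u, 0) (h, 0))) (at u)" .
    define s' where "s' h = fst (snd (G' (u, 0) (h, 0)))" for h
    define \<rho>' where "\<rho>' h = snd (snd (G' (u, 0) (h, 0)))" for h
    have s': "(s has_derivative s') (at u)" and \<rho>': "(\<rho> has_derivative \<rho>') (at u)"
      unfolding s_def[abs_def] s'_def[abs_def] \<rho>_def[abs_def] \<rho>'_def[abs_def]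
      by (intro has_derivative_fst has_derivative_snd G)+
    have X: "((\<lambda>u. horo_geodesic (g u) (\<rho> u)) has_derivative (\<lambda>h. \<phi>' (s u) (s' h))) (at u)"
      by (rule has_derivative_transform_within_open[OF has_derivative_compose[OF s' \<phi>'[OF sol(2)[OF u]]] N(1) u])
        (use sol(3) in auto)
    have "\<rho>' h = action_form g g' u h" for h
      using first_variation[OF g'[OF sol(1)[OF u]] X \<rho>', of h] orth[OF sol(2)[OF u] sol(1)[OF u] sol(3)[OF u], of "s' h"] sol(3)[OF u]
      by (simp add: action_form_apply)
    then have "\<rho>' = blinfun_apply (action_form g g' u)" by blast
    with \<rho>' show ?thesis by simp
  qed
  obtain A' where A': "(action_form g g' has_derivative A') (at u0)"
    using C1_on_action_form[OF C2_on_imp_C1_on[OF C2] C1'] U(2) unfolding C1_on_def by blast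
  obtain g'' where g'': "(g' has_derivative g'') (at u0)"
    using C1' U(2) unfolding C1_on_def by blast
  have "A' h k = A' k h"
    by (rule symmetric_second_derivative[OF N der_\<rho> A'])
  then have "canonical_symplectic (g' u0 h) (g' u0 k) = 0"
    using action_form_exterior_derivative[OF U g' g'' A', of h k] by simp
  then show ?thesis using frechet_derivative_at[OF g'[OF U(2)]] by simp
qed

section \<open>Coordinates on the space of oriented geodesics\<close>

text \<open>Negative \<open>\<sigma>\<close> is used to reverse the geodesics that start at \<open>\<infinity>\<close>.\<close>

lemma meets_orthogonally_reparametrise:
  assumes \<gamma>: "\<And>r. (\<gamma> has_vector_derivative \<gamma>' r) (at r)"
    and \<sigma>: "\<sigma> \<noteq> 0" and \<delta>: "\<And>r. \<delta> r = \<gamma> (\<sigma> * r + c)"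
  shows "meets_orthogonally \<delta> S \<longleftrightarrow> meets_orthogonally \<gamma> S"
proof -
  have \<delta>': "vector_derivative \<delta> (at r) = \<sigma> *\<^sub>R \<gamma>' (\<sigma> * r + c)" for r
  proof -
    have "((\<lambda>r. \<sigma> * r + c) has_vector_derivative \<sigma>) (at r)"
      by (auto intro!: derivative_eq_intros)
    from vector_diff_chain_at[OF this \<gamma>] show ?thesis
      unfolding \<delta>[abs_def] by (simp add: o_def vector_derivative_at)
  qed
  have \<gamma>'v: "vector_derivative \<gamma> (at r) = \<gamma>' r" for r by (rule vector_derivative_at[OF \<gamma>])
  have hyp: "hyp_metric x v (\<sigma> *\<^sub>R w) = \<sigma> * hyp_metric x v w" for x v w
    by (simp add: hyp_metric_def algebra_simps add_divide_distrib)
  have sub: "\<exists>s. r = \<sigma> * s + c" for r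
    using \<sigma> by (intro exI[of _ "(r - c) / \<sigma>"]) simp
  have "range \<delta> = range \<gamma>"
    unfolding \<delta>[abs_def] using sub by (auto simp: image_iff) metis
  moreover have "(\<forall>r. \<delta> r \<in> S \<longrightarrow> (\<forall>v\<in>tangent_space S (\<delta> r). hyp_metric (\<delta> r) v (vector_derivative \<delta> (at r)) = 0))
    \<longleftrightarrow> (\<forall>r. \<gamma> r \<in> S \<longrightarrow> (\<forall>v\<in>tangent_space S (\<gamma> r). hyp_metric (\<gamma> r) v (vector_derivative \<gamma> (at r)) = 0))"
    unfolding \<delta>' \<gamma>'v hyp \<delta> using \<sigma> sub by (metis mult_eq_0_iff)
  ultimately show ?thesis unfolding meets_orthogonally_def by simp
qed

text \<open>The shift by \<open>ln |b|\<close> moves the origin of the parameter to the highest point, as in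
  the definition of \<open>geodesic\<close>.\<close>

lemma horo_geodesic_semicircle:
  assumes "b \<noteq> 0"
  shows "horo_geodesic (a, b) (r - ln (norm b)) =
    (1 / (2 * norm b * cosh r), a + of_real ((1 + tanh r) / 2) / cnj b)"
proof -
  have nb: "norm b > 0" using assms by simp
  have e: "exp (r - ln (norm b)) = exp r / norm b" using nb by (simp add: exp_diff)
  have D: "1 + exp r * exp r > (0::real)" by (simp add: add_pos_pos)
  have h: "height (a, b) (r - ln (norm b)) = exp r / (norm b * (1 + exp r * exp r))"
    unfolding height_def e using nb by (simp add: power_divide power2_eq_square)
  have c: "exp r / (1 + exp r * exp r) = 1 / (2 * cosh r)"
    using D by (simp add: cosh_def exp_minus field_simps)
  have t: "(exp r * exp r) / (1 + exp r * exp r) = (1 + tanh r) / 2"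
  proof -
    have "exp r - exp (- r) = (exp r * exp r - 1) / exp r" "exp r + exp (- r) = (1 + exp r * exp r) / exp r"
      by (simp_all add: exp_minus field_simps)
    then have "tanh r = (exp r * exp r - 1) / (1 + exp r * exp r)" by (simp add: tanh_altdef)
    then show ?thesis using D by (simp add: field_simps)
  qed
  have 1: "height (a, b) (r - ln (norm b)) = 1 / (2 * norm b * cosh r)"
    unfolding h using c nb by (simp add: field_simps)
  have c1: "exp (r - ln (norm b)) * height (a, b) (r - ln (norm b)) = ((1 + tanh r) / 2) / (norm b * norm b)"
    unfolding h e t[symmetric] by simp
  have c2: "(x / (norm b * norm b)) *\<^sub>R b = of_real x / cnj b" for x
    using assms by (simp add: scaleR_conv_of_real field_simps complex_norm_square[unfolded power2_eq_square, symmetric])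
  have 2: "(exp (r - ln (norm b)) * height (a, b) (r - ln (norm b))) *\<^sub>R b = of_real ((1 + tanh r) / 2) / cnj b"
    by (simp only: c1 c2)
  show ?thesis unfolding horo_geodesic_def using 1 2 by simp
qed

lemma horo_geodesic_vertical: "horo_geodesic (a, 0) r = (exp r, a)"
  by (simp add: horo_geodesic_def height_def)

lemma L_H3_iff:
  "(Some m1, Some m2) \<in> L_H3 \<longleftrightarrow> 1 + cnj m1 * m2 \<noteq> 0"
  "(None, Some m2) \<in> L_H3 \<longleftrightarrow> m2 \<noteq> 0"
  "(Some m1, None) \<in> L_H3 \<longleftrightarrow> m1 \<noteq> 0"
  "(None, None) \<in> L_H3"
proof -
  have "m1 * cnj m2 = - 1 \<longleftrightarrow> 1 + cnj m1 * m2 = 0"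
    by (metis add.commute add_eq_0_iff complex_cnj_cnj complex_cnj_minus complex_cnj_mult complex_cnj_one)
  then show "(Some m1, Some m2) \<in> L_H3 \<longleftrightarrow> 1 + cnj m1 * m2 \<noteq> 0"
    by (auto simp: L_H3_def antidiagonal_def)
qed (auto simp: L_H3_def antidiagonal_def)

text \<open>The coordinates \<open>(a, b)\<close> of a geodesic whose initial end point \<open>- \<mu>\<^sub>1\<close> is finite.\<close>

fun forward :: "P1 \<times> P1 \<Rightarrow> complex \<times> complex" where
  "forward (Some m1, Some m2) = (- m1, m2 / (1 + cnj m1 * m2))"
| "forward (Some m1, None) = (- m1, 1 / cnj m1)"
| "forward (None, _) = undefined"

text \<open>The coordinates \<open>(a, b)\<close> of the reversed geodesic, for a finite final end point \<open>1 / cnj \<mu>\<^sub>2\<close>.\<close>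

fun backward :: "P1 \<times> P1 \<Rightarrow> complex \<times> complex" where
  "backward (Some m1, Some m2) = (1 / cnj m2, - m2 / (1 + cnj m1 * m2))"
| "backward (Some m1, None) = (0, - 1 / cnj m1)"
| "backward (None, Some m2) = (1 / cnj m2, 0)"
| "backward (None, None) = (0, 0)"

lemma geodesic_eq_forward:
  assumes "P \<in> L_H3" "fst P \<noteq> None"
  shows "\<exists>c. \<forall>r. geodesic P r = horo_geodesic (forward P) (r + c)"
proof -
  obtain m1 Q where P: "P = (Some m1, Q)" using assms(2) by (cases P) auto
  show ?thesis
  proof (cases Q)
    case None
    then have "m1 \<noteq> 0" using assms(1) P by (simp add: L_H3_iff)
    have "geodesic P r = horo_geodesic (forward P) (r + - ln (norm (1 / cnj m1)))" for r
      unfolding P None forward.simps using horo_geodesic_semicircle[of "1 / cnj m1" "- m1" r] \<open>m1 \<noteq> 0\<close>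
      by (simp add: norm_divide field_simps)
    then show ?thesis by blast
  next
    case (Some m2)
    have M: "1 + cnj m1 * m2 \<noteq> 0" using assms(1) P Some by (simp add: L_H3_iff)
    then have M': "1 + m1 * cnj m2 \<noteq> 0"
      by (metis complex_cnj_add complex_cnj_cnj complex_cnj_mult complex_cnj_one complex_cnj_zero)
    show ?thesis
    proof (cases "m2 = 0")
      case True
      then show ?thesis unfolding P Some by (auto simp: horo_geodesic_vertical intro!: exI[of _ 0])
    next
      case False
      let ?b = "m2 / (1 + cnj m1 * m2)"
      have "geodesic P r = horo_geodesic (forward P) (r + - ln (norm ?b))" for r
        unfolding P Some forward.simps using horo_geodesic_semicircle[of ?b "- m1" r] False M M'
        by (simp add: norm_divide field_simps)
      then show ?thesis by blast
    qed
  qed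
qed

lemma geodesic_eq_backward:
  assumes "P \<in> L_H3" "snd P \<noteq> Some 0"
  shows "\<exists>c. \<forall>r. geodesic P r = horo_geodesic (backward P) (- r + c)"
proof (cases P rule: backward.cases)
  case (1 m1 m2)
  then have m2: "m2 \<noteq> 0" and M: "1 + cnj m1 * m2 \<noteq> 0" using assms by (auto simp: L_H3_iff)
  then have M': "1 + m1 * cnj m2 \<noteq> 0"
    by (metis complex_cnj_add complex_cnj_cnj complex_cnj_mult complex_cnj_one complex_cnj_zero)
  let ?b = "- m2 / (1 + cnj m1 * m2)"
  have "geodesic P r = horo_geodesic (backward P) (- r + - ln (norm ?b))" for r
    unfolding 1 backward.simps using horo_geodesic_semicircle[of ?b "1 / cnj m2" "- r"] m2 M M'
    by (simp add: norm_divide field_simps)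
  then show ?thesis by blast
next
  case (2 m1)
  then have "m1 \<noteq> 0" using assms by (auto simp: L_H3_iff)
  have "geodesic P r = horo_geodesic (backward P) (- r + - ln (norm (- 1 / cnj m1)))" for r
    unfolding 2 backward.simps using horo_geodesic_semicircle[of "- 1 / cnj m1" 0 "- r"] \<open>m1 \<noteq> 0\<close>
    by (simp add: norm_divide field_simps)
  then show ?thesis by blast
qed (auto simp: horo_geodesic_vertical intro!: exI[of _ 0])

text \<open>A map \<open>\<delta>\<close> from the coordinates with index \<open>k\<close> to coordinates \<open>(a, b)\<close> in which the symplectic form is canonical up
  to a constant factor, while the geodesics correspond up to an affine, possibly orientation-reversing, change of parameter.\<close>

definition darboux_chart ::
  "bool \<times> bool \<Rightarrow> (complex \<times> complex) set \<Rightarrow> (complex \<times> complex \<Rightarrow> complex \<times> complex) \<Rightarrow> bool" where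
  "darboux_chart k W \<delta> \<longleftrightarrow> open W \<and> C2_on W \<delta> \<and>
     (\<forall>P\<in>L_dom k. L_coord k P \<in> W \<longrightarrow>
        (\<exists>\<sigma> c. \<sigma> \<noteq> 0 \<and> (\<forall>r. geodesic P r = horo_geodesic (\<delta> (L_coord k P)) (\<sigma> * r + c)))) \<and>
     (\<exists>\<kappa>. \<kappa> \<noteq> 0 \<and> (\<forall>x\<in>W. \<exists>D. (\<delta> has_derivative D) (at x) \<and> inj D \<and>
        (\<forall>u v. L_symplectic k x u v = of_real (\<kappa> * canonical_symplectic (D u) (D v)))))"

lemma canonical_symplectic_altdef:
  "canonical_symplectic p q = Re (snd p * cnj (fst q) - snd q * cnj (fst p))"
  by (simp add: canonical_symplectic_def inner_complex_def)

lemma Omega_eq_Re: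
  "Omega x u v = of_real (- 2 * Re ((snd v * cnj (fst u) - snd u * cnj (fst v)) / (1 + cnj (fst x) * snd x)\<^sup>2))"
proof -
  let ?w = "(snd v * cnj (fst u) - snd u * cnj (fst v)) / (1 + cnj (fst x) * snd x)\<^sup>2"
  have "Omega x u v = - (?w + cnj ?w)"
    by (cases x; cases u; cases v) (simp add: algebra_simps diff_divide_distrib)
  then show ?thesis unfolding complex_add_cnj by simp
qed

lemma Omega_mixed_eq_Re:
  "Omega_mixed x u v = of_real (2 * Re ((snd v * cnj (fst u) - snd u * cnj (fst v)) / (cnj (fst x) + snd x)\<^sup>2))"
proof -
  let ?w = "(snd v * cnj (fst u) - snd u * cnj (fst v)) / (cnj (fst x) + snd x)\<^sup>2"
  have "Omega_mixed x u v = ?w + cnj ?w"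
    by (cases x; cases u; cases v) (simp add: algebra_simps diff_divide_distrib)
  then show ?thesis unfolding complex_add_cnj by simp
qed

text \<open>The numerator is the common bilinear expression in \<open>Omega\<close> and \<open>Omega_mixed\<close>, so this
  yields injectivity of the derivative of any map that pulls the canonical form back to them.\<close>

lemma Re_pairing_nondegenerate:
  assumes "K \<noteq> 0" and "\<And>v. Re ((snd v * cnj (fst u) - snd u * cnj (fst v)) / K) = 0"
  shows "u = (0 :: complex \<times> complex)"
proof -
  have 1: "Re (z * (cnj (fst u) / K)) = 0" for z using assms(2)[of "(0, z)"] by simp
  have 2: "Re (z * (snd u / K)) = 0" for z using assms(2)[of "(- cnj z, 0)"] by (simp add: mult.commute)
  have "w = 0" if "\<And>z. Re (z * w) = 0" for w
    using that[of 1] that[of \<i>] by (simp add: complex_eq_iff)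
  from this[OF 1] this[OF 2] show ?thesis using assms(1) by (simp add: prod_eq_iff)
qed

text \<open>Both forms are real parts of one pairing divided by a function \<open>K\<close>, so an identity
  of complex numbers (\<open>pair\<close>) is enough to compare them.\<close>

lemma darboux_chartI:
  assumes "open W" "C2_on W \<delta>"
    and geod: "\<And>P. P \<in> L_dom k \<Longrightarrow> L_coord k P \<in> W \<Longrightarrow>
        \<exists>c. \<forall>r. geodesic P r = horo_geodesic (\<delta> (L_coord k P)) (\<sigma> * r + c)" and "\<sigma> \<noteq> 0"
    and D: "\<And>x. x \<in> W \<Longrightarrow> (\<delta> has_derivative D x) (at x)"
    and K: "\<And>x. x \<in> W \<Longrightarrow> K x \<noteq> 0"
    and pair: "\<And>x u v. x \<in> W \<Longrightarrow> snd (D x u) * cnj (fst (D x v)) - snd (D x v) * cnj (fst (D x u)) =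
         of_real \<tau> * ((snd v * cnj (fst u) - snd u * cnj (fst v)) / K x)" and "\<tau> \<noteq> 0"
    and Omega: "\<And>x u v. L_symplectic k x u v = of_real (s * Re ((snd v * cnj (fst u) - snd u * cnj (fst v)) / K x))"
    and "s \<noteq> 0"
  shows "darboux_chart k W \<delta>"
proof -
  have cs: "canonical_symplectic (D x u) (D x v) = \<tau> * Re ((snd v * cnj (fst u) - snd u * cnj (fst v)) / K x)"
    if "x \<in> W" for x u v
  proof -
    have "Re (of_real \<tau> * z) = \<tau> * Re z" for z by simp
    then show ?thesis unfolding canonical_symplectic_altdef pair[OF that] .
  qed
  have "\<exists>D. (\<delta> has_derivative D) (at x) \<and> inj D \<and>
        (\<forall>u v. L_symplectic k x u v = of_real (s / \<tau> * canonical_symplectic (D u) (D v)))" if x: "x \<in> W" for x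
  proof (intro exI[of _ "D x"] conjI allI)
    show "(\<delta> has_derivative D x) (at x)" by (rule D[OF x])
    show "L_symplectic k x u v = of_real (s / \<tau> * canonical_symplectic (D x u) (D x v))" for u v
      unfolding cs[OF x] Omega using \<open>\<tau> \<noteq> 0\<close> by simp
    have "u = 0" if "D x u = 0" for u
    proof (rule Re_pairing_nondegenerate[OF K[OF x]])
      show "Re ((snd v * cnj (fst u) - snd u * cnj (fst v)) / K x) = 0" for v
        using cs[OF x, of u v] \<open>\<tau> \<noteq> 0\<close> unfolding that by (simp add: canonical_symplectic_def)
    qed
    then show "inj (D x)"
      using linear_injective_0[OF has_derivative_linear[OF D[OF x]]] by blast
  qed
  moreover have "s / \<tau> \<noteq> 0" using assms by simp
  ultimately show ?thesis
    unfolding darboux_chart_def using assms(1,2,4) geod by blast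
qed

lemma has_derivative_cnj_fst: "((\<lambda>x. cnj (fst x)) has_derivative (\<lambda>u. cnj (fst u))) F"
  by (intro bounded_linear_imp_has_derivative bounded_linear_compose[OF bounded_linear_cnj] bounded_linear_fst)

lemma has_derivative_cnj_snd: "((\<lambda>x. cnj (snd x)) has_derivative (\<lambda>u. cnj (snd u))) F"
  by (intro bounded_linear_imp_has_derivative bounded_linear_compose[OF bounded_linear_cnj] bounded_linear_snd)

lemmas chart_derivative_intros = has_derivative_Pair has_derivative_divide' has_derivative_minus
  has_derivative_add has_derivative_mult has_derivative_const has_derivative_cnj_fst has_derivative_cnj_snd
  has_derivative_fst[OF has_derivative_ident] has_derivative_snd[OF has_derivative_ident]

lemma darboux_chart_FF:
  "darboux_chart (False, False) {x. 1 + cnj (fst x) * snd x \<noteq> 0}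
     (\<lambda>x. (- fst x, snd x / (1 + cnj (fst x) * snd x)))"
proof (rule darboux_chartI[where \<sigma> = 1 and \<tau> = 1 and s = "- 2" and
    K = "\<lambda>x. (1 + cnj (fst x) * snd x)\<^sup>2" and
    D = "\<lambda>x u. (- fst u, (snd u - (snd x)\<^sup>2 * cnj (fst u)) / (1 + cnj (fst x) * snd x)\<^sup>2)"])
  show "open {x :: complex \<times> complex. 1 + cnj (fst x) * snd x \<noteq> 0}"
    by (intro open_Collect_neq continuous_intros)
  show "C2_on {x. 1 + cnj (fst x) * snd x \<noteq> 0} (\<lambda>x. (- fst x, snd x / (1 + cnj (fst x) * snd x)))"
    by (intro C2_on_intros) simp
  show "\<exists>c. \<forall>r. geodesic P r = horo_geodesic (- fst (L_coord (False, False) P),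
      snd (L_coord (False, False) P) / (1 + cnj (fst (L_coord (False, False) P)) * snd (L_coord (False, False) P))) (1 * r + c)"
    if "P \<in> L_dom (False, False)" for P
    using that geodesic_eq_forward[of P]
    by (cases P rule: forward.cases) (auto simp: L_dom_def L_coord_def P1_dom_def P1_coord_def)
  show "((\<lambda>x. (- fst x, snd x / (1 + cnj (fst x) * snd x))) has_derivative
      (\<lambda>u. (- fst u, (snd u - (snd x)\<^sup>2 * cnj (fst u)) / (1 + cnj (fst x) * snd x)\<^sup>2))) (at x)"
    if "x \<in> {x. 1 + cnj (fst x) * snd x \<noteq> 0}" for x :: "complex \<times> complex"
    by (rule has_derivative_eq_rhs, (rule chart_derivative_intros)+)
      (use that in \<open>auto simp: fun_eq_iff power2_eq_square algebra_simps\<close>)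
qed (auto simp: L_symplectic_def Omega_eq_Re divide_simps, auto simp: algebra_simps)

lemma darboux_chart_FT:
  "darboux_chart (False, True) {x. cnj (fst x) + snd x \<noteq> 0}
     (\<lambda>x. (- fst x, 1 / (cnj (fst x) + snd x)))"
proof (rule darboux_chartI[where \<sigma> = 1 and \<tau> = "- 1" and s = 2 and
    K = "\<lambda>x. (cnj (fst x) + snd x)\<^sup>2" and
    D = "\<lambda>x u. (- fst u, - (cnj (fst u) + snd u) / (cnj (fst x) + snd x)\<^sup>2)"])
  show "open {x :: complex \<times> complex. cnj (fst x) + snd x \<noteq> 0}"
    by (intro open_Collect_neq continuous_intros)
  show "C2_on {x. cnj (fst x) + snd x \<noteq> 0} (\<lambda>x. (- fst x, 1 / (cnj (fst x) + snd x)))"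
    by (intro C2_on_intros) simp
  show "\<exists>c. \<forall>r. geodesic P r = horo_geodesic (- fst (L_coord (False, True) P),
      1 / (cnj (fst (L_coord (False, True) P)) + snd (L_coord (False, True) P))) (1 * r + c)"
    if "P \<in> L_dom (False, True)" for P
    using that geodesic_eq_forward[of P]
    by (cases P rule: forward.cases)
      (auto simp: L_dom_def L_coord_def P1_dom_def P1_coord_def L_H3_iff field_simps)
  show "((\<lambda>x. (- fst x, 1 / (cnj (fst x) + snd x))) has_derivative
      (\<lambda>u. (- fst u, - (cnj (fst u) + snd u) / (cnj (fst x) + snd x)\<^sup>2))) (at x)"
    if "x \<in> {x. cnj (fst x) + snd x \<noteq> 0}" for x :: "complex \<times> complex"
    by (rule has_derivative_eq_rhs, (rule chart_derivative_intros)+)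
      (use that in \<open>auto simp: fun_eq_iff power2_eq_square algebra_simps\<close>)
qed (auto simp: L_symplectic_def Omega_mixed_eq_Re divide_simps, auto simp: algebra_simps)

text \<open>Passing from the coordinate \<open>1 / \<mu>\<close> to \<open>\<mu>\<close> in the formula for \<open>b\<close>.\<close>

lemma inverse_mult_divide_add:
  fixes x y :: complex
  assumes "x \<noteq> 0"
  shows "1 / x * y / (1 / x + y) = y / (1 + x * y)"
proof -
  have "1 / x + y = (1 + x * y) / x" using assms by (simp add: field_simps)
  then show ?thesis using assms by simp
qed

text \<open>For the index \<open>(True, False)\<close> both end points may be \<open>\<infinity>\<close>, though not simultaneously; hence this chart for
  a finite initial end point and \<open>darboux_chart_TF_backward\<close> for a finite final one.\<close>

lemma darboux_chart_TF_forward: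
  "darboux_chart (True, False) {x. cnj (fst x) + snd x \<noteq> 0 \<and> fst x \<noteq> 0}
     (\<lambda>x. (- 1 / fst x, cnj (fst x) * snd x / (cnj (fst x) + snd x)))"
  (is "darboux_chart _ ?W _")
proof (rule darboux_chartI[where \<sigma> = 1 and \<tau> = "- 1" and s = 2 and
    K = "\<lambda>x. (cnj (fst x) + snd x)\<^sup>2" and
    D = "\<lambda>x u. (fst u / (fst x)\<^sup>2,
      (cnj (fst u) * (snd x)\<^sup>2 + (cnj (fst x))\<^sup>2 * snd u) / (cnj (fst x) + snd x)\<^sup>2)"])
  show "open ?W"
    by (intro open_Collect_conj open_Collect_neq continuous_intros)
  show "C2_on ?W (\<lambda>x. (- 1 / fst x, cnj (fst x) * snd x / (cnj (fst x) + snd x)))"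
    by (intro C2_on_intros) simp_all
  show "\<exists>c. \<forall>r. geodesic P r = horo_geodesic (- 1 / fst (L_coord (True, False) P),
      cnj (fst (L_coord (True, False) P)) * snd (L_coord (True, False) P) /
       (cnj (fst (L_coord (True, False) P)) + snd (L_coord (True, False) P))) (1 * r + c)"
    if PW: "P \<in> L_dom (True, False)" "L_coord (True, False) P \<in> ?W" for P
  proof -
    have P: "P \<in> L_H3" using PW(1) by (simp add: L_dom_def)
    obtain m1 m2 where m: "P = (Some m1, Some m2)" "m1 \<noteq> 0"
      using PW by (cases P rule: backward.cases) (auto simp: L_dom_def L_coord_def P1_dom_def P1_coord_def)
    have "(- 1 / fst (L_coord (True, False) P), cnj (fst (L_coord (True, False) P)) * snd (L_coord (True, False) P) /
       (cnj (fst (L_coord (True, False) P)) + snd (L_coord (True, False) P))) = forward P"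
      using m inverse_mult_divide_add[of "cnj m1" m2] by (simp add: L_coord_def P1_coord_def)
    then show ?thesis using geodesic_eq_forward[OF P] m(1) by (simp del: geodesic.simps forward.simps)
  qed
  show "((\<lambda>x. (- 1 / fst x, cnj (fst x) * snd x / (cnj (fst x) + snd x))) has_derivative
      (\<lambda>u. (fst u / (fst x)\<^sup>2,
      (cnj (fst u) * (snd x)\<^sup>2 + (cnj (fst x))\<^sup>2 * snd u) / (cnj (fst x) + snd x)\<^sup>2))) (at x)"
    if "x \<in> ?W" for x :: "complex \<times> complex"
  proof -
    have nz: "fst x \<noteq> 0" "cnj (fst x) + snd x \<noteq> 0" using that by auto
    show ?thesis
      by (rule has_derivative_eq_rhs, (rule chart_derivative_intros nz)+, intro ext prod_eqI;
          simp only: fst_conv snd_conv; intro arg_cong2[where f = "(/)"];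
          simp add: power2_eq_square algebra_simps)
  qed
qed (auto simp: L_symplectic_def Omega_mixed_eq_Re divide_simps, auto simp: algebra_simps)

lemma darboux_chart_TT:
  "darboux_chart (True, True) {x. 1 + cnj (fst x) * snd x \<noteq> 0}
     (\<lambda>x. (cnj (snd x), - cnj (fst x) / (1 + cnj (fst x) * snd x)))"
  (is "darboux_chart _ ?W _")
proof (rule darboux_chartI[where \<sigma> = "- 1" and \<tau> = "- 1" and s = "- 2" and
    K = "\<lambda>x. (1 + cnj (fst x) * snd x)\<^sup>2" and
    D = "\<lambda>x u. (cnj (snd u), - (cnj (fst u) - (cnj (fst x))\<^sup>2 * snd u) / (1 + cnj (fst x) * snd x)\<^sup>2)"])
  show "open ?W"
    by (intro open_Collect_neq continuous_intros)
  show "C2_on ?W (\<lambda>x. (cnj (snd x), - cnj (fst x) / (1 + cnj (fst x) * snd x)))"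
    by (intro C2_on_intros) simp
  show "\<exists>c. \<forall>r. geodesic P r = horo_geodesic (cnj (snd (L_coord (True, True) P)),
      - cnj (fst (L_coord (True, True) P)) /
       (1 + cnj (fst (L_coord (True, True) P)) * snd (L_coord (True, True) P))) (- 1 * r + c)"
    if "P \<in> L_dom (True, True)" for P
    using that geodesic_eq_backward[of P]
    by (cases P rule: backward.cases)
      (auto simp: L_dom_def L_coord_def P1_dom_def P1_coord_def L_H3_iff field_simps)
  show "((\<lambda>x. (cnj (snd x), - cnj (fst x) / (1 + cnj (fst x) * snd x))) has_derivative
      (\<lambda>u. (cnj (snd u), - (cnj (fst u) - (cnj (fst x))\<^sup>2 * snd u) / (1 + cnj (fst x) * snd x)\<^sup>2))) (at x)"
    if "x \<in> ?W" for x :: "complex \<times> complex"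
    by (rule has_derivative_eq_rhs, (rule chart_derivative_intros)+)
      (use that in \<open>auto simp: fun_eq_iff power2_eq_square algebra_simps\<close>)
qed (auto simp: L_symplectic_def Omega_eq_Re divide_simps, auto simp: algebra_simps)

lemma darboux_chart_TF_backward:
  "darboux_chart (True, False) {x. cnj (fst x) + snd x \<noteq> 0 \<and> snd x \<noteq> 0}
     (\<lambda>x. (1 / cnj (snd x), - (cnj (fst x) * snd x) / (cnj (fst x) + snd x)))"
  (is "darboux_chart _ ?W _")
proof (rule darboux_chartI[where \<sigma> = "- 1" and \<tau> = 1 and s = 2 and
    K = "\<lambda>x. (cnj (fst x) + snd x)\<^sup>2" and
    D = "\<lambda>x u. (- cnj (snd u) / (cnj (snd x))\<^sup>2,
      - (cnj (fst u) * (snd x)\<^sup>2 + (cnj (fst x))\<^sup>2 * snd u) / (cnj (fst x) + snd x)\<^sup>2)"])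
  show "open ?W"
    by (intro open_Collect_conj open_Collect_neq continuous_intros)
  show "C2_on ?W (\<lambda>x. (1 / cnj (snd x), - (cnj (fst x) * snd x) / (cnj (fst x) + snd x)))"
    by (intro C2_on_intros) simp_all
  show "\<exists>c. \<forall>r. geodesic P r = horo_geodesic (1 / cnj (snd (L_coord (True, False) P)),
      - (cnj (fst (L_coord (True, False) P)) * snd (L_coord (True, False) P)) /
       (cnj (fst (L_coord (True, False) P)) + snd (L_coord (True, False) P))) (- 1 * r + c)"
    if PW: "P \<in> L_dom (True, False)" "L_coord (True, False) P \<in> ?W" for P
  proof -
    have P: "P \<in> L_H3" using PW(1) by (simp add: L_dom_def)
    obtain m2 where m2: "snd P = Some m2" "m2 \<noteq> 0"
      using PW by (cases P rule: backward.cases) (auto simp: L_dom_def L_coord_def P1_dom_def P1_coord_def)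
    have "(1 / cnj (snd (L_coord (True, False) P)), - (cnj (fst (L_coord (True, False) P)) * snd (L_coord (True, False) P)) /
       (cnj (fst (L_coord (True, False) P)) + snd (L_coord (True, False) P))) = backward P"
    proof (cases "fst P")
      case None
      then show ?thesis using m2 by (cases P) (simp add: L_coord_def P1_coord_def)
    next
      case (Some m1)
      then have "m1 \<noteq> 0" using PW(1) by (cases P) (auto simp: L_dom_def P1_dom_def)
      then show ?thesis
        using m2 Some inverse_mult_divide_add[of "cnj m1" m2]
        by (cases P) (simp add: L_coord_def P1_coord_def)
    qed
    then show ?thesis using geodesic_eq_backward[OF P] m2 by (simp del: geodesic.simps backward.simps)
  qed
  show "((\<lambda>x. (1 / cnj (snd x), - (cnj (fst x) * snd x) / (cnj (fst x) + snd x))) has_derivative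
      (\<lambda>u. (- cnj (snd u) / (cnj (snd x))\<^sup>2,
      - (cnj (fst u) * (snd x)\<^sup>2 + (cnj (fst x))\<^sup>2 * snd u) / (cnj (fst x) + snd x)\<^sup>2))) (at x)"
    if "x \<in> ?W" for x :: "complex \<times> complex"
  proof -
    have nz: "cnj (snd x) \<noteq> 0" "cnj (fst x) + snd x \<noteq> 0" using that by auto
    show ?thesis
      by (rule has_derivative_eq_rhs, (rule chart_derivative_intros nz)+, intro ext prod_eqI;
          simp only: fst_conv snd_conv; intro arg_cong2[where f = "(/)"];
          simp add: power2_eq_square algebra_simps)
  qed
qed (auto simp: L_symplectic_def Omega_mixed_eq_Re divide_simps, auto simp: algebra_simps)

lemma darboux_chart_exists:
  assumes "P \<in> L_dom k"
  shows "\<exists>W \<delta>. L_coord k P \<in> W \<and> darboux_chart k W \<delta>"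
proof -
  obtain i j where k: "k = (i, j)" by (cases k)
  have P: "P \<in> L_H3" "fst P \<in> P1_dom i" "snd P \<in> P1_dom j" using assms k by (auto simp: L_dom_def)
  show ?thesis
  proof (cases i; cases j)
    assume "\<not> i" "\<not> j"
    then have "L_coord k P \<in> {x. 1 + cnj (fst x) * snd x \<noteq> 0}"
      using P k by (cases P rule: backward.cases) (auto simp: L_coord_def P1_coord_def P1_dom_def L_H3_iff)
    then show ?thesis using darboux_chart_FF \<open>\<not> i\<close> \<open>\<not> j\<close> k by auto
  next
    assume "\<not> i" "j"
    then have "L_coord k P \<in> {x. cnj (fst x) + snd x \<noteq> 0}"
      using P k by (cases P rule: backward.cases)
        (auto simp: L_coord_def P1_coord_def P1_dom_def L_H3_iff divide_simps add.commute)
    then show ?thesis using darboux_chart_FT \<open>\<not> i\<close> \<open>j\<close> k by auto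
  next
    assume "i" "j"
    then have "L_coord k P \<in> {x. 1 + cnj (fst x) * snd x \<noteq> 0}"
      using P k by (cases P rule: backward.cases)
        (auto simp: L_coord_def P1_coord_def P1_dom_def L_H3_iff divide_simps add.commute)
    then show ?thesis using darboux_chart_TT \<open>i\<close> \<open>j\<close> k by auto
  next
    assume ij: "i" "\<not> j"
    then have *: "cnj (fst (L_coord k P)) + snd (L_coord k P) \<noteq> 0"
      using P k by (cases P rule: backward.cases)
        (auto simp: L_coord_def P1_coord_def P1_dom_def L_H3_iff divide_simps add.commute mult.commute)
    have kTF: "k = (True, False)" using ij k by simp
    show ?thesis
    proof (cases "fst (L_coord k P) = 0")
      case True
      with * have "L_coord (True, False) P \<in> {x. cnj (fst x) + snd x \<noteq> 0 \<and> snd x \<noteq> 0}"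
        unfolding kTF by simp
      from conjI[OF this darboux_chart_TF_backward] show ?thesis unfolding kTF by (intro exI)
    next
      case False
      with * have "L_coord (True, False) P \<in> {x. cnj (fst x) + snd x \<noteq> 0 \<and> fst x \<noteq> 0}"
        unfolding kTF by simp
      from conjI[OF this darboux_chart_TF_forward] show ?thesis unfolding kTF by (intro exI)
    qed
  qed
qed

section \<open>Congruences in canonical coordinates\<close>

lemma chart_domain:
  assumes "C2_surface M A" "c \<in> A"
  shows "openin M (fst c)" "open (snd c ` fst c)"
    "homeomorphic_map (subtopology M (fst c)) (top_of_set (snd c ` fst c)) (snd c)"
    "topspace (subtopology M (fst c)) = fst c"
proof -
  show *: "openin M (fst c)" "open (snd c ` fst c)"
    "homeomorphic_map (subtopology M (fst c)) (top_of_set (snd c ` fst c)) (snd c)"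
    using assms unfolding C2_surface_def by (auto simp: case_prod_beta)
  show "topspace (subtopology M (fst c)) = fst c"
    by (rule topspace_subtopology_subset[OF openin_subset[OF *(1)]])
qed

lemma chart_inj_on:
  assumes "C2_surface M A" "c \<in> A"
  shows "inj_on (snd c) (fst c)"
  using homeomorphic_imp_injective_map[OF chart_domain(3)[OF assms]] unfolding chart_domain(4)[OF assms] .

lemma chart_open_image:
  assumes "C2_surface M A" "c \<in> A" "openin M W"
  shows "open (snd c ` (fst c \<inter> W))"
proof -
  note hom = chart_domain(3)[OF assms(1,2)] and opn = chart_domain(2)[OF assms(1,2)]
  have "openin (subtopology M (fst c)) (fst c \<inter> W)"
    using assms(3) by (simp add: openin_subtopology_Int2)
  then have "openin (top_of_set (snd c ` fst c)) (snd c ` (fst c \<inter> W))"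
    using homeomorphic_imp_open_map[OF hom] by (simp add: open_map_def)
  then show ?thesis using opn by (simp add: openin_open_eq)
qed

lemma chart_open_vimage:
  assumes "C2_surface M A" "c \<in> A" "open B"
  shows "openin M {q \<in> fst c. snd c q \<in> B}"
proof -
  note hom = chart_domain(3)[OF assms(1,2)] and opn = chart_domain(1)[OF assms(1,2)]
    and top = chart_domain(4)[OF assms(1,2)]
  have "openin (top_of_set (snd c ` fst c)) (snd c ` fst c \<inter> B)"
    using assms(3) by blast
  then have "openin (subtopology M (fst c)) {q \<in> topspace (subtopology M (fst c)). snd c q \<in> snd c ` fst c \<inter> B}"
    by (rule openin_continuous_map_preimage[OF homeomorphic_imp_continuous_map[OF hom]])
  moreover have "{q \<in> topspace (subtopology M (fst c)). snd c q \<in> snd c ` fst c \<inter> B} = {q \<in> fst c. snd c q \<in> B}"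
    unfolding top by auto
  ultimately show ?thesis using openin_trans_full[OF _ opn] by simp
qed

text \<open>Near each of its members a congruence is given by a map \<open>g\<close> into the coordinates \<open>(a, b)\<close>,
  for which the Lagrangian condition and the orthogonality condition take the form treated above.\<close>

lemma darboux_representative:
  assumes cong: "geodesic_congruence M A f" and c: "c \<in> A" and p: "p \<in> fst c" "f p \<in> L_dom k"
  shows "\<exists>U g \<kappa>. open U \<and> U \<subseteq> snd c ` {q \<in> fst c. f q \<in> L_dom k} \<and> snd c p \<in> U \<and> C2_on U g \<and> \<kappa> \<noteq> 0 \<and>
    (\<forall>q\<in>fst c. snd c q \<in> U \<longrightarrow>
       (\<forall>S. meets_orthogonally (geodesic (f q)) S \<longleftrightarrow> meets_orthogonally (horo_geodesic (g (snd c q))) S) \<and>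
       inj (frechet_derivative g (at (snd c q))) \<and>
       (\<forall>u v. L_symplectic k (L_coord k (f q)) (frechet_derivative (local_rep f k c) (at (snd c q)) u)
           (frechet_derivative (local_rep f k c) (at (snd c q)) v)
         = of_real (\<kappa> * canonical_symplectic (frechet_derivative g (at (snd c q)) u)
             (frechet_derivative g (at (snd c q)) v))))"
proof -
  let ?N = "{q \<in> fst c. f q \<in> L_dom k}"
  let ?h = "local_rep f k c"
  obtain W \<delta> where W: "L_coord k (f p) \<in> W" and chart: "darboux_chart k W \<delta>"
    using darboux_chart_exists[OF p(2)] by blast
  obtain \<kappa> where \<kappa>: "\<kappa> \<noteq> 0" "\<And>x. x \<in> W \<Longrightarrow> \<exists>D. (\<delta> has_derivative D) (at x) \<and> inj D \<and>
        (\<forall>u v. L_symplectic k x u v = of_real (\<kappa> * canonical_symplectic (D u) (D v)))"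
    using chart unfolding darboux_chart_def by blast
  have C2\<delta>: "open W" "C2_on W \<delta>" using chart unfolding darboux_chart_def by auto
  have surf: "C2_surface M A" and imm: "C2_immersion_on (snd c ` ?N) ?h"
    using cong c unfolding geodesic_congruence_def by blast+
  have U0: "open (snd c ` ?N)" and C2h: "C2_on (snd c ` ?N) ?h"
    and injh: "\<And>x. x \<in> snd c ` ?N \<Longrightarrow> inj (frechet_derivative ?h (at x))"
    using imm unfolding C2_immersion_on_def by auto
  have inj_c: "inj_on (snd c) (fst c)" by (rule chart_inj_on[OF surf c])
  have h: "?h (snd c q) = L_coord k (f q)" if "q \<in> fst c" for q
    using that inj_c by (simp add: local_rep_def)
  define U where "U = snd c ` ?N \<inter> ?h -` W"
  have "open U" unfolding U_def
    by (rule continuous_open_preimage[OF C1_on_imp_continuous_on[OF C2_on_imp_C1_on[OF C2h]] U0 C2\<delta>(1)])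
  define g where "g x = \<delta> (?h x)" for x
  have C2g: "C2_on U g" unfolding g_def
    by (rule C2_on_compose[OF C2\<delta>(2) C2_on_subset[OF C2h]]) (auto simp: U_def)
  have main: "(\<forall>S. meets_orthogonally (geodesic (f q)) S \<longleftrightarrow> meets_orthogonally (horo_geodesic (g (snd c q))) S) \<and>
       inj (frechet_derivative g (at (snd c q))) \<and>
       (\<forall>u v. L_symplectic k (L_coord k (f q)) (frechet_derivative ?h (at (snd c q)) u)
           (frechet_derivative ?h (at (snd c q)) v)
         = of_real (\<kappa> * canonical_symplectic (frechet_derivative g (at (snd c q)) u)
             (frechet_derivative g (at (snd c q)) v)))"
    if q: "q \<in> fst c" "snd c q \<in> U" for q
  proof -
    have qN: "f q \<in> L_dom k" and qW: "L_coord k (f q) \<in> W"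
      using q inj_c h[OF q(1)] by (auto simp: U_def inj_on_def)
    obtain \<sigma> b where \<sigma>: "\<sigma> \<noteq> 0" "\<And>r. geodesic (f q) r = horo_geodesic (\<delta> (L_coord k (f q))) (\<sigma> * r + b)"
      using chart qN qW unfolding darboux_chart_def by blast
    have "meets_orthogonally (geodesic (f q)) S \<longleftrightarrow> meets_orthogonally (horo_geodesic (g (snd c q))) S" for S
      unfolding g_def h[OF q(1)] by (rule meets_orthogonally_reparametrise[OF horo_geodesic_has_velocity \<sigma>])
    moreover obtain D where D: "(\<delta> has_derivative D) (at (L_coord k (f q)))" "inj D"
      "\<And>u v. L_symplectic k (L_coord k (f q)) u v = of_real (\<kappa> * canonical_symplectic (D u) (D v))"
      using \<kappa>(2)[OF qW] by blast
    obtain h' where h': "(?h has_derivative h') (at (snd c q))"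
      using C2h q(2) unfolding C2_on_def U_def by blast
    have "(g has_derivative (\<lambda>u. D (h' u))) (at (snd c q))"
      unfolding g_def[abs_def] using has_derivative_compose[OF h', of \<delta> D] D(1) h[OF q(1)] by simp
    then have g': "frechet_derivative g (at (snd c q)) = (\<lambda>u. D (h' u))"
      by (simp add: frechet_derivative_at[symmetric])
    have h'': "frechet_derivative ?h (at (snd c q)) = h'"
      using h' by (simp add: frechet_derivative_at[symmetric])
    have "inj h'" using injh[of "snd c q"] q(2) h'' by (auto simp: U_def)
    then have "inj (\<lambda>u. D (h' u))" using inj_compose[OF D(2)] by (simp add: o_def)
    ultimately show ?thesis unfolding g' h'' using D(3) by simp
  qed
  have "snd c p \<in> U" using p W h[OF p(1)] by (auto simp: U_def)
  then show ?thesis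
    using \<open>open U\<close> C2g \<kappa>(1) main
    by (intro exI[of _ U] exI[of _ g] exI[of _ \<kappa>] conjI ballI impI) (auto simp: U_def)
qed

theorem proposition5:
  fixes M :: "'m topology"
    and A :: "('m set \<times> ('m \<Rightarrow> real^2)) set"
    and f :: "'m \<Rightarrow> P1 \<times> P1"
  assumes "geodesic_congruence M A f"
  shows "integrable_congruence M f \<longleftrightarrow> lagrangian_congruence M A f"
proof
  have surf: "C2_surface M A" and range: "f ` topspace M \<subseteq> L_H3"
    using assms unfolding geodesic_congruence_def by auto
  {
    assume int: "integrable_congruence M f"
    have "L_symplectic k (L_coord k (f p)) (frechet_derivative (local_rep f k c) (at (snd c p)) u)
           (frechet_derivative (local_rep f k c) (at (snd c p)) v) = 0"
      if p: "p \<in> topspace M" and c: "c \<in> A" "p \<in> fst c" "f p \<in> L_dom k" for p c k u v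
    proof -
      obtain W S where W: "openin M W" "p \<in> W" and S: "embedded_surface S"
        and meets: "\<And>q. q \<in> W \<Longrightarrow> meets_orthogonally (geodesic (f q)) S"
        using bspec[OF int[unfolded integrable_congruence_def] p]
        by (elim exE conjE) (rule that, assumption+, erule bspec)
      obtain U g \<kappa> where U: "open U" "snd c p \<in> U" "C2_on U g"
        and rep: "\<And>q S. q \<in> fst c \<Longrightarrow> snd c q \<in> U \<Longrightarrow>
          meets_orthogonally (geodesic (f q)) S \<longleftrightarrow> meets_orthogonally (horo_geodesic (g (snd c q))) S"
          "\<And>q u v. q \<in> fst c \<Longrightarrow> snd c q \<in> U \<Longrightarrow>
           L_symplectic k (L_coord k (f q)) (frechet_derivative (local_rep f k c) (at (snd c q)) u)
             (frechet_derivative (local_rep f k c) (at (snd c q)) v)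
           = of_real (\<kappa> * canonical_symplectic (frechet_derivative g (at (snd c q)) u)
               (frechet_derivative g (at (snd c q)) v))"
        using darboux_representative[OF assms c] by blast
      have "canonical_symplectic (frechet_derivative g (at (snd c p)) u) (frechet_derivative g (at (snd c p)) v) = 0"
      proof (rule orthogonal_surface_imp_lagrangian[OF _ _ C2_on_subset[OF U(3)] S])
        show "open (U \<inter> snd c ` (fst c \<inter> W))"
          by (intro open_Int U chart_open_image[OF surf c(1) W(1)])
        show "meets_orthogonally (horo_geodesic (g x)) S" if "x \<in> U \<inter> snd c ` (fst c \<inter> W)" for x
          using that rep(1) meets by auto
      qed (use U c W in auto)
      then show ?thesis using rep(2)[OF c(2) U(2)] by simp
    qed
    then show "lagrangian_congruence M A f"
      unfolding lagrangian_congruence_def Let_def by blast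
  next
    assume lag: "lagrangian_congruence M A f"
    have "\<exists>W S. openin M W \<and> p \<in> W \<and> embedded_surface S \<and>
        (\<forall>q\<in>W. meets_orthogonally (geodesic (f q)) S)" if p: "p \<in> topspace M" for p
    proof -
      obtain c where c: "c \<in> A" "p \<in> fst c"
      proof -
        have "(\<Union>(U, \<phi>)\<in>A. U) = topspace M" using surf unfolding C2_surface_def by blast
        then have "p \<in> (\<Union>(U, \<phi>)\<in>A. U)" using p by simp
        then show ?thesis using that by force
      qed
      have "f p \<in> L_dom (fst (f p) = None, snd (f p) = None)"
        using range p by (auto simp: L_dom_def P1_dom_def mem_Times_iff)
      then obtain k where k: "f p \<in> L_dom k" by blast
      obtain U g \<kappa> where U: "open U" "snd c p \<in> U" "C2_on U g" "U \<subseteq> snd c ` {q \<in> fst c. f q \<in> L_dom k}"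
          and \<kappa>: "\<kappa> \<noteq> 0"
        and rep: "\<And>q S. q \<in> fst c \<Longrightarrow> snd c q \<in> U \<Longrightarrow>
          meets_orthogonally (geodesic (f q)) S \<longleftrightarrow> meets_orthogonally (horo_geodesic (g (snd c q))) S"
          "\<And>q u v. q \<in> fst c \<Longrightarrow> snd c q \<in> U \<Longrightarrow>
           L_symplectic k (L_coord k (f q)) (frechet_derivative (local_rep f k c) (at (snd c q)) u)
             (frechet_derivative (local_rep f k c) (at (snd c q)) v)
           = of_real (\<kappa> * canonical_symplectic (frechet_derivative g (at (snd c q)) u)
               (frechet_derivative g (at (snd c q)) v))"
          "\<And>q. q \<in> fst c \<Longrightarrow> snd c q \<in> U \<Longrightarrow> inj (frechet_derivative g (at (snd c q)))"
        using darboux_representative[OF assms c k] by blast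
      have isotropic: "canonical_symplectic (frechet_derivative g (at x) u) (frechet_derivative g (at x) v) = 0"
        if x: "x \<in> U" for x u v
      proof -
        obtain q where q: "q \<in> fst c" "f q \<in> L_dom k" "x = snd c q" using U(4) x by blast
        have "q \<in> topspace M"
          using openin_subset[OF chart_domain(1)[OF surf c(1)]] q(1) by blast
        then have "L_symplectic k (L_coord k (f q)) (frechet_derivative (local_rep f k c) (at (snd c q)) u)
             (frechet_derivative (local_rep f k c) (at (snd c q)) v) = 0"
          using lag c(1) q unfolding lagrangian_congruence_def Let_def by blast
        then show ?thesis using rep(2)[OF q(1), of u v] x \<kappa> unfolding q(3) by simp
      qed
      obtain \<epsilon> S where \<epsilon>: "\<epsilon> > 0" "ball (snd c p) \<epsilon> \<subseteq> U" and S: "embedded_surface S"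
        and meets: "\<And>x. x \<in> ball (snd c p) \<epsilon> \<Longrightarrow> meets_orthogonally (horo_geodesic (g x)) S"
        using lagrangian_imp_orthogonal_surface[OF U(1,2,3) rep(3)[OF c(2) U(2)] isotropic] by blast
      show ?thesis
      proof (intro exI[of _ "{q \<in> fst c. snd c q \<in> ball (snd c p) \<epsilon>}"] exI[of _ S] conjI ballI)
        show "openin M {q \<in> fst c. snd c q \<in> ball (snd c p) \<epsilon>}"
          by (rule chart_open_vimage[OF surf c(1) open_ball])
        show "p \<in> {q \<in> fst c. snd c q \<in> ball (snd c p) \<epsilon>}" using c(2) \<epsilon>(1) by simp
        show "embedded_surface S" by (rule S)
        show "meets_orthogonally (geodesic (f q)) S" if "q \<in> {q \<in> fst c. snd c q \<in> ball (snd c p) \<epsilon>}" for q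
          using that rep(1)[of q S] meets[of "snd c q"] \<epsilon>(2) by blast
      qed
    qed
    then show "integrable_congruence M f"
      unfolding integrable_congruence_def by blast
  }
qed

end
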